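(* Let $\mu$ be a finite positive Borel measure on the interval $[0,1)$. If $0<\beta\le 2$, then $\mathcal{C}_\mu:\mathcal{B}\to\mathcal{B}^{\beta}$ is compact if and only if $$\lim_{t\to 1^-}\frac{\mu([t,1))\log\frac{e}{1-t}}{(1-t)^{2-\beta}}=0.$$
   Context: Let $\mathbb{D}=\{z\in\mathbb{C}:|z|<1\}$ and let $H(\mathbb{D})$ be the space of all analytic functions in $\mathbb{D}$. For $0<\alpha<\infty$, the Bloch-type space is $\mathcal{B}^{\alpha}=\{f\in H(\mathbb{D}):\|f\|_{\mathcal{B}^\alpha}=|f(0)|+\sup_{z\in\mathbb{D}}(1-|z|^2)^{\alpha}|f'(z)|<\infty\}$, and $\mathcal{B}=\mathcal{B}^1$ is the classical Bloch space. For a finite positive Borel measure $\mu$ on $[0,1)$ and $f(z)=\sum_{n=0}^\infty a_nz^n\in H(\mathbb{D})$, the Cesàro-like operator is $$\mathcal{C}_\mu(f)(z)=\sum_{n=0}^\infty\left(\mu_n\sum_{k=0}^n a_k\right)z^n=\int_{[0,1)}\frac{f(tz)}{1-tz}\,d\mu(t),\quad z\in\mathbb{D},$$ where $\mu_n=\int_{[0,1)}t^n\,d\mu(t)$. *)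

theory Defs
  imports "HOL-Complex_Analysis.Complex_Analysis"
begin

abbreviation unit_disc :: "complex set" where
  "unit_disc \<equiv> ball 0 1"

text \<open>
  HOL functions are total, so an analytic function on the disc is represented by its unique
  extension by zero; this makes the Bloch norms definite and the spaces linear subspaces of
  the function space.
\<close>

definition analytic_disc :: "(complex \<Rightarrow> complex) set" where
  "analytic_disc = {f. f holomorphic_on unit_disc \<and> (\<forall>z. z \<notin> unit_disc \<longrightarrow> f z = 0)}"

definition bloch :: "real \<Rightarrow> (complex \<Rightarrow> complex) set" where
  "bloch \<alpha> = {f \<in> analytic_disc.
     bdd_above ((\<lambda>z. (1 - (cmod z)\<^sup>2) powr \<alpha> * cmod (deriv f z)) ` unit_disc)}"

definition bloch_norm :: "real \<Rightarrow> (complex \<Rightarrow> complex) \<Rightarrow> real" where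
  "bloch_norm \<alpha> f =
     cmod (f 0) + (SUP z\<in>unit_disc. (1 - (cmod z)\<^sup>2) powr \<alpha> * cmod (deriv f z))"

text \<open>
  The library's metric space locale requires nonnegativity and symmetry on the whole type, and
  outside of the carrier the real supremum is unspecified; hence the guard.
\<close>

definition bloch_dist :: "real \<Rightarrow> (complex \<Rightarrow> complex) \<Rightarrow> (complex \<Rightarrow> complex) \<Rightarrow> real" where
  "bloch_dist \<alpha> f g =
     (if f \<in> bloch \<alpha> \<and> g \<in> bloch \<alpha> then bloch_norm \<alpha> (\<lambda>z. f z - g z) else 0)"

definition taylor_coeff :: "(complex \<Rightarrow> complex) \<Rightarrow> nat \<Rightarrow> complex" where
  "taylor_coeff f n = (deriv ^^ n) f 0 / fact n"

definition moment :: "real measure \<Rightarrow> nat \<Rightarrow> real" where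
  "moment \<mu> n = (\<integral>t. t ^ n \<partial>\<mu>)"

definition cesaro_like :: "real measure \<Rightarrow> (complex \<Rightarrow> complex) \<Rightarrow> complex \<Rightarrow> complex" where
  "cesaro_like \<mu> f z =
     (if z \<in> unit_disc
      then (\<Sum>n. of_real (moment \<mu> n) * (\<Sum>k\<le>n. taylor_coeff f k) * z ^ n)
      else 0)"

text \<open>
  Compactness of an operator between normed spaces that are given by carrier sets \<open>X\<close>, \<open>Y\<close> and
  the metrics \<open>d\<close>, \<open>d'\<close> of their norms: \<open>T\<close> maps \<open>X\<close> into \<open>Y\<close> and bounded sets to relatively
  compact ones.  Linearity is not part of this predicate.
\<close>

definition compact_operator ::
  "'a set \<Rightarrow> ('a \<Rightarrow> 'a \<Rightarrow> real) \<Rightarrow> 'b set \<Rightarrow> ('b \<Rightarrow> 'b \<Rightarrow> real) \<Rightarrow> ('a \<Rightarrow> 'b) \<Rightarrow> bool" where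
  "compact_operator X d Y d' T \<longleftrightarrow>
     T \<in> X \<rightarrow> Y \<and>
     (\<forall>S. Metric_space.mbounded X d S \<longrightarrow>
        compactin (Metric_space.mtopology Y d') (Metric_space.mtopology Y d' closure_of (T ` S)))"

text \<open>The following justifies the use of the \<open>Metric_space\<close> constants for the Bloch spaces.\<close>

lemma Metric_space_bloch: "Metric_space (bloch \<alpha>) (bloch_dist \<alpha>)"
proof -
  define w where "w f z = (1 - (cmod z)\<^sup>2) powr \<alpha> * cmod (deriv f z)" for f z
  have norm_w: "bloch_norm \<alpha> f = cmod (f 0) + (SUP z\<in>unit_disc. w f z)" for f
    by (simp add: bloch_norm_def w_def)
  have bdd: "bdd_above (w f ` unit_disc)" if "f \<in> bloch \<alpha>" for f
    using that by (simp add: bloch_def w_def)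
  have dfb: "f field_differentiable (at z)" if "f \<in> bloch \<alpha>" "z \<in> unit_disc" for f z
    using that by (auto simp: bloch_def analytic_disc_def intro: holomorphic_on_imp_differentiable_at)
  have w_nonneg: "0 \<le> w f z" for f z by (simp add: w_def)
  have w_diff: "w (\<lambda>z. f z - h z) z \<le> w (\<lambda>z. f z - g z) z + w (\<lambda>z. g z - h z) z"
    if "f \<in> bloch \<alpha>" "g \<in> bloch \<alpha>" "h \<in> bloch \<alpha>" "z \<in> unit_disc" for f g h z
  proof -
    have "cmod (deriv f z - deriv h z) \<le> cmod (deriv f z - deriv g z) + cmod (deriv g z - deriv h z)"
      by (metis dist_norm dist_triangle)
    then show ?thesis
      using that dfb by (simp add: w_def flip: distrib_left) (simp add: mult_left_mono)
  qed
  have bdd_diff: "bdd_above (w (\<lambda>z. f z - g z) ` unit_disc)"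
    if fg: "f \<in> bloch \<alpha>" "g \<in> bloch \<alpha>" for f g
  proof -
    obtain A B where A: "\<And>z. z \<in> unit_disc \<Longrightarrow> w f z \<le> A" and B: "\<And>z. z \<in> unit_disc \<Longrightarrow> w g z \<le> B"
      using bdd[OF fg(1)] bdd[OF fg(2)] unfolding bdd_above_def by blast
    show ?thesis
    proof (rule bdd_aboveI2)
      fix z assume z: "z \<in> unit_disc"
      have "w (\<lambda>z. f z - g z) z \<le> w f z + w g z"
        using fg z dfb norm_triangle_ineq4[of "deriv f z" "deriv g z"]
        by (simp add: w_def flip: distrib_left) (simp add: mult_left_mono)
      then show "w (\<lambda>z. f z - g z) z \<le> A + B" using A[OF z] B[OF z] by linarith
    qed
  qed
  have upper: "w (\<lambda>z. f z - g z) z \<le> (SUP z\<in>unit_disc. w (\<lambda>z. f z - g z) z)"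
    if "f \<in> bloch \<alpha>" "g \<in> bloch \<alpha>" "z \<in> unit_disc" for f g z
    using bdd_diff that by (intro cSUP_upper)
  have sup_nonneg: "0 \<le> (SUP z\<in>unit_disc. w (\<lambda>z. f z - g z) z)"
    if "f \<in> bloch \<alpha>" "g \<in> bloch \<alpha>" for f g
    using upper[OF that, of 0] w_nonneg[of "\<lambda>z. f z - g z" 0] by simp
  have zero: "f = g" if fg: "f \<in> bloch \<alpha>" "g \<in> bloch \<alpha>" and "bloch_dist \<alpha> f g = 0" for f g
  proof -
    have S0: "(SUP z\<in>unit_disc. w (\<lambda>z. f z - g z) z) = 0" and f0: "f 0 - g 0 = 0"
      using that(3) sup_nonneg[OF fg] fg norm_ge_zero[of "f 0 - g 0"] unfolding bloch_dist_def norm_w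
      by (simp_all add: add_nonneg_eq_0_iff)
    have "((\<lambda>z. f z - g z) has_field_derivative 0) (at z within unit_disc)" if z: "z \<in> unit_disc" for z
    proof -
      have "w (\<lambda>z. f z - g z) z = 0"
        using upper[OF fg z] w_nonneg[of "\<lambda>z. f z - g z" z] S0 by simp
      moreover have "(cmod z)\<^sup>2 < 1" using z by (simp add: abs_square_less_1)
      ultimately have "deriv (\<lambda>z. f z - g z) z = 0" by (simp add: w_def)
      moreover have "(\<lambda>z. f z - g z) field_differentiable (at z)"
        using dfb fg z by (intro field_differentiable_diff)
      ultimately show ?thesis
        by (metis DERIV_deriv_iff_field_differentiable has_field_derivative_at_within)
    qed
    then obtain c where c: "\<And>z. z \<in> unit_disc \<Longrightarrow> f z - g z = c"
      using has_field_derivative_zero_constant[of unit_disc "\<lambda>z. f z - g z"] by auto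
    have "c = 0" using c[of 0] f0 by simp
    then have "f z = g z" if "z \<in> unit_disc" for z using c[OF that] by simp
    moreover have "f z = g z" if "z \<notin> unit_disc" for z
      using that fg by (auto simp: bloch_def analytic_disc_def)
    ultimately show ?thesis by blast
  qed
  have w_comm: "w (\<lambda>z. f z - g z) z = w (\<lambda>z. g z - f z) z"
    if "f \<in> bloch \<alpha>" "g \<in> bloch \<alpha>" "z \<in> unit_disc" for f g z
    using that dfb by (simp add: w_def norm_minus_commute)
  show ?thesis
  proof
    show "0 \<le> bloch_dist \<alpha> f g" for f g
      using sup_nonneg by (simp add: bloch_dist_def norm_w)
    show "bloch_dist \<alpha> f g = bloch_dist \<alpha> g f" for f g
      using w_comm by (auto simp: bloch_dist_def norm_w norm_minus_commute intro!: SUP_cong)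
    show "(bloch_dist \<alpha> f g = 0) = (f = g)" if "f \<in> bloch \<alpha>" "g \<in> bloch \<alpha>" for f g
      using zero[OF that] by (auto simp: bloch_dist_def bloch_norm_def)
    show "bloch_dist \<alpha> f h \<le> bloch_dist \<alpha> f g + bloch_dist \<alpha> g h"
      if fgh: "f \<in> bloch \<alpha>" "g \<in> bloch \<alpha>" "h \<in> bloch \<alpha>" for f g h
    proof -
      have "(SUP z\<in>unit_disc. w (\<lambda>z. f z - h z) z) \<le>
          (SUP z\<in>unit_disc. w (\<lambda>z. f z - g z) z) + (SUP z\<in>unit_disc. w (\<lambda>z. g z - h z) z)"
      proof (rule cSUP_least)
        fix z :: complex assume z: "z \<in> unit_disc"
        show "w (\<lambda>z. f z - h z) z \<le>
          (SUP z\<in>unit_disc. w (\<lambda>z. f z - g z) z) + (SUP z\<in>unit_disc. w (\<lambda>z. g z - h z) z)"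
          using w_diff[OF fgh z] upper[OF fgh(1,2) z] upper[OF fgh(2,3) z] by linarith
      qed simp
      moreover have "cmod (f 0 - h 0) \<le> cmod (f 0 - g 0) + cmod (g 0 - h 0)"
        by (metis dist_norm dist_triangle)
      ultimately show ?thesis
        using fgh by (simp add: bloch_dist_def norm_w)
    qed
  qed
qed

end

theory Submission
  imports Defs
begin

text \<open>
  Integrating the power series of \<open>f w / (1 - w)\<close> against \<open>\<mu>\<close> gives
  \<open>(C f)' z = \<integral> t K(t z) d\<mu>(t)\<close> with \<open>K w = f' w / (1 - w) + f w / (1 - w)\<^sup>2\<close>.

  Sufficiency: a Bloch function grows at most logarithmically, so \<open>\<bar>K w\<bar>\<close> is at most
  \<open>2 \<parallel>f\<parallel> k(\<bar>w\<bar>)\<close> with \<open>k s = (1 - ln (1 - s)) / (1 - s)\<^sup>2\<close>.  The truncated integrals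
  \<open>J n = \<integral> k(min t (1 - 2\<^sup>-\<^sup>n)) d\<mu>(t)\<close> grow from \<open>n\<close> to \<open>n + 1\<close> by at most \<open>k\<close> times the
  measure of a tail, and the hypothesis on the tails turns this into a contracting recurrence for
  \<open>J n / 2 powr (n \<beta>)\<close> with vanishing perturbation.  Hence the weighted derivative of \<open>C f\<close> is small
  near the boundary, uniformly on bounded sets, and Montel's theorem takes care of the interior.

  Necessity: the functions \<open>(1 - Ln (1 - a z))\<^sup>2 / (1 - ln (1 - a))\<close> are bounded in the Bloch
  space and tend to 0 locally uniformly as \<open>a\<close> tends to 1, so any limit point of their images has
  zero derivative; but the derivative of the image at \<open>z = a\<close> dominates the tail \<open>\<mu>([a,1))\<close>
  times \<open>(1 - ln (1 - a)) / (1 - a)\<^sup>2\<close>.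
\<close>

section \<open>Moments and the integral representation\<close>

text \<open>The sigma-algebra is that of the subspace, so \<open>space \<mu>\<close> is
  \<open>{0..<1}\<close> itself and integrals against \<open>\<mu>\<close> carry no
  indicator.\<close>

locale unit_interval_measure = finite_measure \<mu> for \<mu> :: "real measure" +
  assumes sets_eq: "sets \<mu> = sets (restrict_space borel {0..<1})"
begin

lemma space_eq: "space \<mu> = {0..<1}"
  using sets_eq_imp_space_eq[OF sets_eq] by (simp add: space_restrict_space)

lemma tail_measurable: "0 \<le> a \<Longrightarrow> {a..<1} \<in> sets \<mu>"
  unfolding sets_eq by (subst sets_restrict_space_iff) auto

lemma integrable_continuous:
  fixes f :: "real \<Rightarrow> 'a::{banach, second_countable_topology}"
  assumes "continuous_on {0..<1} f" and "\<And>t. 0 \<le> t \<Longrightarrow> t < 1 \<Longrightarrow> norm (f t) \<le> B"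
  shows "integrable \<mu> f"
proof (rule integrable_const_bound)
  show "AE t in \<mu>. norm (f t) \<le> B"
    using assms(2) by (intro AE_I2) (simp add: space_eq)
  show "f \<in> borel_measurable \<mu>"
    using borel_measurable_continuous_on_restrict[OF assms(1)] measurable_cong_sets[OF sets_eq refl]
    by blast
qed

lemma moment_eq_integral: "of_real (moment \<mu> n) = (\<integral>t. complex_of_real (t ^ n) \<partial>\<mu>)"
  unfolding moment_def by (rule integral_complex_of_real[symmetric])

text \<open>Sum and integral may be exchanged because \<open>t ^ k * t ^ n\<close> is at most 1, so
  the terms are dominated by the absolutely convergent series at \<open>z\<close>. The case
  \<open>k = 0\<close> yields the operator, \<open>k = 1\<close> its derivative.\<close>

lemma moment_power_series_sums:
  fixes c :: "nat \<Rightarrow> complex"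
  assumes H: "\<And>w. cmod w < 1 \<Longrightarrow> (\<lambda>n. c n * w ^ n) sums H w" and z: "cmod z < 1"
  shows "(\<lambda>n. c n * of_real (moment \<mu> (n + k)) * z ^ n) sums
      (\<integral>t. of_real (t ^ k) * H (of_real t * z) \<partial>\<mu>)"
proof -
  define u where "u n t = of_real (t ^ k) * (c n * (of_real t * z) ^ n)" for n and t :: real
  have norm_u: "norm (u n t) \<le> norm (c n * z ^ n)" if "0 \<le> t" "t < 1" for n t
  proof -
    have "norm (u n t) = t ^ k * t ^ n * norm (c n * z ^ n)"
      using that by (simp add: u_def norm_mult norm_power power_mult_distrib algebra_simps)
    also have "t ^ k * t ^ n \<le> 1"
      using that by (simp add: mult_le_one power_le_one)
    finally show ?thesis by (simp add: mult_right_mono)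
  qed
  \<comment> \<open>The point \<open>(1 + cmod z) / 2\<close> lies strictly between
    \<open>cmod z\<close> and 1; convergence there forces absolute convergence at
    \<open>z\<close>.\<close>
  have summable: "summable (\<lambda>n. norm (c n * z ^ n))"
  proof -
    have "norm (complex_of_real ((1 + cmod z) / 2)) = (1 + cmod z) / 2"
      unfolding norm_of_real by simp
    then show ?thesis
      using z sums_summable[OF H, of "of_real ((1 + cmod z) / 2)"]
      by (intro powser_insidea[of c "of_real ((1 + cmod z) / 2)"]) simp_all
  qed
  have int_u: "integrable \<mu> (u n)" for n
    unfolding u_def using norm_u[unfolded u_def]
    by (intro integrable_continuous continuous_intros)
  have "(\<lambda>n. \<integral>t. u n t \<partial>\<mu>) sums (\<integral>t. (\<Sum>n. u n t) \<partial>\<mu>)"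
  proof (rule sums_integral)
    show "AE t in \<mu>. summable (\<lambda>n. norm (u n t))"
      using norm_u by (intro AE_I2 summable_comparison_test'[OF summable])
        (simp only: real_norm_def abs_norm_cancel space_eq atLeastLessThan_iff)
    have "norm (\<integral>t. norm (u n t) \<partial>\<mu>) \<le> measure \<mu> (space \<mu>) * norm (c n * z ^ n)" for n
    proof -
      have "(\<integral>t. norm (u n t) \<partial>\<mu>) \<le> (\<integral>t. norm (c n * z ^ n) \<partial>\<mu>)"
        by (intro integral_mono integrable_norm int_u)
          (simp_all only: norm_u space_eq atLeastLessThan_iff integrable_const)
      then show ?thesis by simp
    qed
    then show "summable (\<lambda>n. \<integral>t. norm (u n t) \<partial>\<mu>)"
      by (rule summable_comparison_test'[OF summable_mult[OF summable]])
  qed (rule int_u)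
  moreover have "(\<integral>t. u n t \<partial>\<mu>) = c n * of_real (moment \<mu> (n + k)) * z ^ n" for n
  proof -
    have "u n = (\<lambda>t. (c n * z ^ n) * of_real (t ^ (n + k)))"
      by (simp add: u_def power_add power_mult_distrib fun_eq_iff)
    then have "(\<integral>t. u n t \<partial>\<mu>) = (c n * z ^ n) * of_real (moment \<mu> (n + k))"
      by (simp only: moment_eq_integral integral_mult_right_zero)
    then show ?thesis by simp
  qed
  moreover have "(\<integral>t. (\<Sum>n. u n t) \<partial>\<mu>) = (\<integral>t. of_real (t ^ k) * H (of_real t * z) \<partial>\<mu>)"
  proof (rule Bochner_Integration.integral_cong[OF refl])
    fix t assume "t \<in> space \<mu>"
    then have "cmod (of_real t * z) < 1"
      using z mult_strict_mono'[of t 1 "cmod z" 1] by (simp add: space_eq norm_mult)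
    then show "(\<Sum>n. u n t) = of_real (t ^ k) * H (of_real t * z)"
      using sums_mult[OF H] by (intro sums_unique[symmetric]) (simp add: u_def)
  qed
  ultimately show ?thesis by simp
qed

end

section \<open>Integral formula for the derivative of the image\<close>

text \<open>Cauchy product of the Taylor series of \<open>f\<close> with the geometric
  series.\<close>

lemma partial_sums_generating_function:
  assumes f: "f holomorphic_on unit_disc" and w: "cmod w < 1"
  shows "(\<lambda>n. (\<Sum>k\<le>n. taylor_coeff f k) * w ^ n) sums (f w / (1 - w))"
proof -
  have f_sums: "(\<lambda>n. taylor_coeff f n * v ^ n) sums f v" if "cmod v < 1" for v
    using holomorphic_power_series[OF f, of v] that by (simp add: taylor_coeff_def)
  have "norm (complex_of_real ((1 + cmod w) / 2)) = (1 + cmod w) / 2"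
    unfolding norm_of_real by simp
  then have "summable (\<lambda>n. norm (taylor_coeff f n * w ^ n))"
    using w sums_summable[OF f_sums, of "of_real ((1 + cmod w) / 2)"]
    by (intro powser_insidea[of _ "of_real ((1 + cmod w) / 2)"]) simp_all
  moreover have "summable (\<lambda>n. norm (w ^ n))"
    using w by (simp add: norm_power)
  ultimately have "(\<lambda>n. \<Sum>k\<le>n. (taylor_coeff f k * w ^ k) * w ^ (n - k)) sums
      ((\<Sum>n. taylor_coeff f n * w ^ n) * (\<Sum>n. w ^ n))"
    by (rule Cauchy_product_sums)
  moreover have "(\<Sum>k\<le>n. (taylor_coeff f k * w ^ k) * w ^ (n - k)) = (\<Sum>k\<le>n. taylor_coeff f k) * w ^ n" for n
    by (simp add: sum_distrib_right mult.assoc flip: power_add)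
  ultimately show ?thesis
    using sums_unique[OF f_sums[OF w]] suminf_geometric[OF w] by simp
qed

lemma quotient_field_derivative:
  assumes f: "f holomorphic_on unit_disc" and w: "cmod w < 1"
  shows "((\<lambda>w. f w / (1 - w)) has_field_derivative (deriv f w / (1 - w) + f w / (1 - w)\<^sup>2)) (at w)"
proof -
  have "(f has_field_derivative deriv f w) (at w)"
    using holomorphic_derivI[OF f, of w] w by simp
  moreover have nz: "1 - w \<noteq> 0" using w by auto
  ultimately have "((\<lambda>w. f w / (1 - w)) has_field_derivative
      (deriv f w * (1 - w) - f w * (0 - 1)) / ((1 - w) * (1 - w))) (at w)"
    by (intro DERIV_divide derivative_intros)
  moreover have "(deriv f w * v - f w * (0 - 1)) / (v * v) = deriv f w / v + f w / v\<^sup>2"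
    if "v \<noteq> 0" for v
    using that by (simp add: add_divide_distrib power2_eq_square)
  ultimately show ?thesis using nz by metis
qed

text \<open>The derivative of \<open>f w / (1 - w)\<close>, whose dilations are averaged by the
  operator.\<close>

definition cesaro_kernel :: "(complex \<Rightarrow> complex) \<Rightarrow> complex \<Rightarrow> complex" where
  "cesaro_kernel f w = deriv f w / (1 - w) + f w / (1 - w)\<^sup>2"

context unit_interval_measure
begin

text \<open>\<open>cesaro_like\<close> is defined by a bare infinite sum; its convergence comes from
  the integral representation with \<open>k = 0\<close>.\<close>

lemma cesaro_like_sums:
  assumes "f holomorphic_on unit_disc" "cmod z < 1"
  shows "(\<lambda>n. (\<Sum>k\<le>n. taylor_coeff f k) * of_real (moment \<mu> n) * z ^ n) sums cesaro_like \<mu> f z"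
proof -
  have "(\<lambda>n. (\<Sum>k\<le>n. taylor_coeff f k) * of_real (moment \<mu> n) * z ^ n) sums
      (\<integral>t. f (of_real t * z) / (1 - of_real t * z) \<partial>\<mu>)"
    using moment_power_series_sums[OF partial_sums_generating_function[OF assms(1)] assms(2), where k=0]
    by simp
  from sums_summable[OF this] show ?thesis
    using assms(2) by (simp add: cesaro_like_def summable_sums mult.commute)
qed

lemma cesaro_like_0:
  assumes "f holomorphic_on unit_disc"
  shows "cesaro_like \<mu> f 0 = of_real (moment \<mu> 0) * f 0"
proof -
  have "cesaro_like \<mu> f 0 = (\<Sum>k\<le>0. taylor_coeff f k) * of_real (moment \<mu> 0)"
    using sums_unique2[OF cesaro_like_sums[OF assms, of 0] powser_sums_zero] by simp
  then show ?thesis by (simp add: taylor_coeff_def)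
qed

lemma cesaro_like_analytic:
  assumes "f holomorphic_on unit_disc"
  shows "cesaro_like \<mu> f \<in> analytic_disc"
proof -
  have "cesaro_like \<mu> f holomorphic_on unit_disc"
    using cesaro_like_sums[OF assms] by (intro power_series_holomorphic) simp
  then show ?thesis by (simp add: analytic_disc_def cesaro_like_def)
qed

text \<open>Termwise differentiation shifts the moments by one index: \<open>diffs\<close> of the
  coefficients \<open>s n * moment \<mu> n\<close> is
  \<open>diffs s n * moment \<mu> (n + 1)\<close>. Since \<open>diffs s\<close> are the coefficients
  of the kernel, the case \<open>k = 1\<close> of the moment lemma identifies the sum.\<close>

lemma deriv_cesaro_like:
  assumes f: "f holomorphic_on unit_disc" and z: "cmod z < 1"
  shows "deriv (cesaro_like \<mu> f) z = (\<integral>t. of_real t * cesaro_kernel f (of_real t * z) \<partial>\<mu>)"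
proof -
  define s where "s n = (\<Sum>k\<le>n. taylor_coeff f k)" for n
  have "(cesaro_like \<mu> f has_field_derivative deriv (cesaro_like \<mu> f) z) (at z)"
    using cesaro_like_analytic[OF f] z
    by (intro holomorphic_derivI[of _ unit_disc]) (auto simp: analytic_disc_def)
  then have "(\<lambda>n. diffs (\<lambda>n. s n * of_real (moment \<mu> n)) n * z ^ n) sums deriv (cesaro_like \<mu> f) z"
    using termdiffs_sums_strong[OF cesaro_like_sums[OF f] _ z] unfolding s_def by blast
  moreover have "(\<lambda>n. diffs s n * w ^ n) sums cesaro_kernel f w" if "cmod w < 1" for w
    using termdiffs_sums_strong[OF partial_sums_generating_function[OF f]
        quotient_field_derivative[OF f that] that]
    unfolding s_def cesaro_kernel_def .
  from moment_power_series_sums[OF this z, where k=1]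
  have "(\<lambda>n. diffs s n * of_real (moment \<mu> (n + 1)) * z ^ n) sums
      (\<integral>t. of_real t * cesaro_kernel f (of_real t * z) \<partial>\<mu>)"
    by simp
  moreover have "diffs (\<lambda>n. s n * of_real (moment \<mu> n)) n = diffs s n * of_real (moment \<mu> (n + 1))" for n
    by (simp add: diffs_def)
  ultimately show ?thesis
    using sums_unique2 by simp
qed

end

lemma cesaro_kernel_holomorphic:
  assumes "f holomorphic_on unit_disc"
  shows "cesaro_kernel f holomorphic_on unit_disc"
  unfolding cesaro_kernel_def[abs_def]
  using assms by (intro holomorphic_intros) auto

lemma of_real_times_in_disc:
  assumes "0 \<le> t" "t < 1" "cmod z < 1"
  shows "cmod (of_real t * z) \<le> cmod z" "cmod (of_real t * z) < 1"
  using assms mult_left_le_one_le[of "cmod z" t] by (auto simp: norm_mult)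

context unit_interval_measure
begin

text \<open>The points \<open>t * z\<close> stay in the closed disc of radius \<open>cmod z\<close>,
  a compact set on which \<open>H\<close> is bounded.\<close>

lemma integrable_dilation:
  assumes "H holomorphic_on unit_disc" "cmod z < 1"
  shows "integrable \<mu> (\<lambda>t. of_real t * H (of_real t * z))"
proof -
  have cont: "continuous_on unit_disc H"
    using assms(1) by (rule holomorphic_on_imp_continuous_on)
  have "continuous_on (cball 0 (cmod z)) H"
    using assms(2) by (intro continuous_on_subset[OF cont]) auto
  then have "compact (H ` cball 0 (cmod z))"
    by (rule compact_continuous_image) simp
  then obtain B where B: "\<And>w. cmod w \<le> cmod z \<Longrightarrow> cmod (H w) \<le> B"
    using compact_imp_bounded[THEN bounded_iff[THEN iffD1]] by force
  show ?thesis
  proof (rule integrable_continuous)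
    show "continuous_on {0..<1} (\<lambda>t. complex_of_real t * H (of_real t * z))"
      using of_real_times_in_disc assms(2)
      by (intro continuous_intros continuous_on_compose2[OF cont]) auto
    show "cmod (of_real t * H (of_real t * z)) \<le> B" if "0 \<le> t" "t < 1" for t
      using of_real_times_in_disc[OF that assms(2)] B[of "of_real t * z"] that
        mult_left_le_one_le[of "cmod (H (of_real t * z))" t]
      by (simp add: norm_mult)
  qed
qed

text \<open>The crude estimate for the interior of the disc, where a uniform bound for the kernel is
  available.\<close>

lemma norm_deriv_cesaro_like_le:
  assumes f: "f holomorphic_on unit_disc" and z: "cmod z < 1"
    and B: "\<And>w. cmod w \<le> cmod z \<Longrightarrow> cmod (cesaro_kernel f w) \<le> B"
  shows "cmod (deriv (cesaro_like \<mu> f) z) \<le> B * measure \<mu> (space \<mu>)"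
proof -
  have "cmod (deriv (cesaro_like \<mu> f) z) \<le> (\<integral>t. B \<partial>\<mu>)"
    unfolding deriv_cesaro_like[OF f z]
  proof (rule Bochner_Integration.integral_norm_bound_integral)
    fix t assume "t \<in> space \<mu>"
    then have t: "0 \<le> t" "t < 1" by (auto simp: space_eq)
    show "cmod (of_real t * cesaro_kernel f (of_real t * z)) \<le> B"
      using of_real_times_in_disc[OF t z] B[of "of_real t * z"] t
        mult_left_le_one_le[of "cmod (cesaro_kernel f (of_real t * z))" t]
      by (simp add: norm_mult)
  qed (auto intro: integrable_dilation cesaro_kernel_holomorphic f z)
  then show ?thesis by (simp add: mult.commute)
qed

lemma deriv_cesaro_like_diff:
  assumes f: "f holomorphic_on unit_disc" and g: "g holomorphic_on unit_disc" and z: "cmod z < 1"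
  shows "deriv (cesaro_like \<mu> (\<lambda>z. f z - g z)) z = deriv (cesaro_like \<mu> f) z - deriv (cesaro_like \<mu> g) z"
proof -
  have "deriv (\<lambda>z. f z - g z) w = deriv f w - deriv g w" if "cmod w < 1" for w
    using f g that by (intro deriv_diff holomorphic_on_imp_differentiable_at[where s=unit_disc]) auto
  then have "cesaro_kernel (\<lambda>z. f z - g z) w = cesaro_kernel f w - cesaro_kernel g w" if "cmod w < 1" for w
    using that by (simp add: cesaro_kernel_def diff_divide_distrib)
  then have "deriv (cesaro_like \<mu> (\<lambda>z. f z - g z)) z =
     (\<integral>t. of_real t * cesaro_kernel f (of_real t * z) - of_real t * cesaro_kernel g (of_real t * z) \<partial>\<mu>)"
    using deriv_cesaro_like[OF holomorphic_on_diff[OF f g] z] of_real_times_in_disc[OF _ _ z]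
    by (auto intro!: Bochner_Integration.integral_cong simp: space_eq right_diff_distrib)
  also have "\<dots> = deriv (cesaro_like \<mu> f) z - deriv (cesaro_like \<mu> g) z"
    unfolding deriv_cesaro_like[OF f z] deriv_cesaro_like[OF g z]
    by (intro Bochner_Integration.integral_diff integrable_dilation cesaro_kernel_holomorphic f g z)
  finally show ?thesis .
qed

end

section \<open>Growth of Bloch functions and of the kernel\<close>

lemma bloch_holomorphic: "f \<in> bloch \<alpha> \<Longrightarrow> f holomorphic_on unit_disc"
  by (simp add: bloch_def analytic_disc_def)

lemma bloch_deriv_le:
  assumes "f \<in> bloch \<alpha>" "cmod z < 1"
  shows "(1 - (cmod z)\<^sup>2) powr \<alpha> * cmod (deriv f z) \<le> bloch_norm \<alpha> f - cmod (f 0)"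
  using assms unfolding bloch_def bloch_norm_def by (auto intro!: cSUP_upper)

lemma norm_0_le_bloch_norm:
  assumes "f \<in> bloch \<alpha>"
  shows "cmod (f 0) \<le> bloch_norm \<alpha> f"
proof -
  have "0 \<le> (1 - (cmod 0)\<^sup>2) powr \<alpha> * cmod (deriv f 0)" by simp
  from order_trans[OF this bloch_deriv_le[OF assms, of 0]] show ?thesis by simp
qed

lemma
  assumes f: "f \<in> analytic_disc"
    and le: "\<And>z. cmod z < 1 \<Longrightarrow> (1 - (cmod z)\<^sup>2) powr \<alpha> * cmod (deriv f z) \<le> B"
  shows blochI: "f \<in> bloch \<alpha>" and bloch_norm_le: "bloch_norm \<alpha> f \<le> cmod (f 0) + B"
proof -
  show "f \<in> bloch \<alpha>"
    using f le unfolding bloch_def by (auto intro!: bdd_aboveI2[where M=B])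
  have "(SUP z\<in>unit_disc. (1 - (cmod z)\<^sup>2) powr \<alpha> * cmod (deriv f z)) \<le> B"
    by (rule cSUP_least) (use le in auto)
  then show "bloch_norm \<alpha> f \<le> cmod (f 0) + B"
    by (simp add: bloch_norm_def)
qed

lemma one_minus_norm_le:
  assumes "cmod z < 1"
  shows "1 - cmod z \<le> 1 - (cmod z)\<^sup>2" "1 - (cmod z)\<^sup>2 \<le> 2 * (1 - cmod z)"
proof -
  have "1 - (cmod z)\<^sup>2 = (1 - cmod z) * (1 + cmod z)"
    by (simp add: power2_eq_square algebra_simps)
  then show "1 - cmod z \<le> 1 - (cmod z)\<^sup>2" "1 - (cmod z)\<^sup>2 \<le> 2 * (1 - cmod z)"
    using mult_left_mono[of "1 + cmod z" 2 "1 - cmod z"] mult_left_mono[of 1 "1 + cmod z" "1 - cmod z"] assms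
    by (auto simp: mult.commute)
qed

text \<open>Mean value inequality along the segment from 0 to \<open>w\<close>: the function
  \<open>- A * ln (1 - t * cmod w)\<close> has derivative
  \<open>A * cmod w / (1 - t * cmod w)\<close>, which dominates the speed of \<open>f\<close> on the
  segment.\<close>

lemma holomorphic_log_growth:
  assumes f: "f holomorphic_on unit_disc" and w: "cmod w < 1"
    and deriv_le: "\<And>z. cmod z < 1 \<Longrightarrow> cmod (deriv f z) \<le> A / (1 - cmod z)"
  shows "cmod (f w - f 0) \<le> - A * ln (1 - cmod w)"
proof -
  have small: "cmod (of_real t * w) < 1" "1 - t * cmod w > 0" if "0 \<le> t" "t \<le> 1" for t
  proof -
    have "t * cmod w \<le> 1 * cmod w" using that by (intro mult_right_mono) auto
    then show "cmod (of_real t * w) < 1" "1 - t * cmod w > 0"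
      using that w by (simp_all add: norm_mult)
  qed
  let ?g = "f \<circ> (\<lambda>t. of_real t * w)"
  let ?\<phi> = "\<lambda>t. - A * ln (1 - t * cmod w)"
  have "norm (?g 1 - ?g 0) \<le> ?\<phi> 1 - ?\<phi> 0"
  proof (rule differentiable_bound_general)
    show "continuous_on {0..1} ?g"
      using holomorphic_on_imp_continuous_on[OF f] small
      by (intro continuous_on_compose) (auto intro!: continuous_intros intro: continuous_on_subset)
    show "continuous_on {0..1} ?\<phi>"
      using small by (intro continuous_intros) (auto simp: less_imp_neq[symmetric])
    fix t :: real assume t: "0 < t" "t < 1"
    have "((\<lambda>t. of_real t * w) has_vector_derivative w) (at t)"
      by (auto intro!: derivative_eq_intros)
    moreover have "(f has_field_derivative deriv f (of_real t * w)) (at (of_real t * w))"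
      using holomorphic_derivI[OF f open_ball, of "of_real t * w"] small t by simp
    ultimately show "(?g has_vector_derivative w * deriv f (of_real t * w)) (at t)"
      using field_vector_diff_chain_at by blast
    have "(?\<phi> has_real_derivative A * cmod w / (1 - t * cmod w)) (at t)"
      using small[of t] t by (auto intro!: derivative_eq_intros)
    then show "(?\<phi> has_vector_derivative A * cmod w / (1 - t * cmod w)) (at t)"
      by (simp add: has_real_derivative_iff_has_vector_derivative)
    show "norm (w * deriv f (of_real t * w)) \<le> A * cmod w / (1 - t * cmod w)"
      using mult_left_mono[OF deriv_le[of "of_real t * w"], of "cmod w"] small[of t] t
      by (simp add: norm_mult mult.commute)
  qed simp
  then show ?thesis by simp
qed

text \<open>The logarithmic growth of a Bloch function times the double pole in the second summand
  of the kernel.\<close>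

definition log_kernel :: "real \<Rightarrow> real" where
  "log_kernel s = (1 - ln (1 - s)) / (1 - s)\<^sup>2"

lemma log_kernel_mono:
  assumes "0 \<le> s" "s \<le> t" "t < 1"
  shows "log_kernel s \<le> log_kernel t"
proof -
  have "ln (1 - t) \<le> 0" using assms by simp
  then show ?thesis
    unfolding log_kernel_def
    using assms by (intro frac_le power_mono diff_left_mono) (simp_all del: ln_le_zero_iff)
qed

lemma log_kernel_nonneg: "0 \<le> s \<Longrightarrow> s < 1 \<Longrightarrow> 0 \<le> log_kernel s"
  using order_trans[OF _ log_kernel_mono[of 0 s]] by (simp add: log_kernel_def)

lemma continuous_on_log_kernel: "continuous_on {..<1} log_kernel"
  unfolding log_kernel_def by (intro continuous_intros) auto

text \<open>With \<open>A\<close> the supremum part of the norm \<open>M\<close>, integrating the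
  bound on the derivative gives the growth estimate, since \<open>cmod (f 0)\<close> and
  \<open>A\<close> are both at most \<open>M\<close>. In the kernel each of the two summands is at
  most \<open>M * log_kernel r\<close>, the first because \<open>1 \<le> 1 - ln (1 - r)\<close>;
  this is the factor 2.\<close>

lemma
  assumes f: "f \<in> bloch 1" and w: "cmod w < 1"
  shows bloch_growth: "cmod (f w) \<le> bloch_norm 1 f * (1 - ln (1 - cmod w))"
    and cesaro_kernel_le: "cmod (cesaro_kernel f w) \<le> 2 * bloch_norm 1 f * log_kernel (cmod w)"
proof -
  define r where "r = cmod w"
  define M where "M = bloch_norm 1 f"
  define A where "A = M - cmod (f 0)"
  have r: "0 \<le> r" "r < 1" using w by (auto simp: r_def)
  have A: "0 \<le> A" "A \<le> M" using norm_0_le_bloch_norm[OF f] by (auto simp: A_def M_def)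
  have ln: "ln (1 - r) \<le> 0" using r by simp
  have deriv_le: "cmod (deriv f z) \<le> A / (1 - cmod z)" if z: "cmod z < 1" for z
  proof -
    have "(cmod z)\<^sup>2 < 1" using z by (simp add: abs_square_less_1)
    then have "(1 - cmod z) * cmod (deriv f z) \<le> A"
      using bloch_deriv_le[OF f z] one_minus_norm_le(1)[OF z]
        mult_right_mono[of "1 - cmod z" "1 - (cmod z)\<^sup>2" "cmod (deriv f z)"]
      by (simp add: A_def M_def)
    then show ?thesis using z by (simp add: field_simps)
  qed
  have "cmod (f w) \<le> cmod (f 0) + cmod (f w - f 0)"
    using norm_triangle_ineq[of "f 0" "f w - f 0"] by simp
  also have "\<dots> \<le> cmod (f 0) - A * ln (1 - r)"
    using holomorphic_log_growth[OF bloch_holomorphic[OF f] w deriv_le] by (simp add: r_def)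
  also have "\<dots> \<le> M - M * ln (1 - r)"
    using mult_right_mono_neg[OF A(2) ln] norm_0_le_bloch_norm[OF f] unfolding M_def by linarith
  finally have f_le: "cmod (f w) \<le> M * (1 - ln (1 - r))" by (simp add: right_diff_distrib)
  then show "cmod (f w) \<le> bloch_norm 1 f * (1 - ln (1 - cmod w))" by (simp add: r_def M_def)
  have den: "1 - r \<le> cmod (1 - w)"
    using norm_triangle_ineq2[of 1 w] by (simp add: r_def)
  have "cmod (deriv f w / (1 - w)) \<le> (A / (1 - r)) / (1 - r)"
    unfolding norm_divide using deriv_le[OF w] den A r by (intro frac_le) (auto simp: r_def)
  also have "\<dots> = A * 1 / (1 - r)\<^sup>2" by (simp add: power2_eq_square)
  also have "\<dots> \<le> M * (1 - ln (1 - r)) / (1 - r)\<^sup>2"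
    using A ln by (intro divide_right_mono mult_mono) auto
  finally have 1: "cmod (deriv f w / (1 - w)) \<le> M * log_kernel r"
    by (simp add: log_kernel_def)
  have "cmod (f w / (1 - w)\<^sup>2) \<le> M * (1 - ln (1 - r)) / (1 - r)\<^sup>2"
    unfolding norm_divide norm_power using f_le den r order_trans[OF norm_ge_zero f_le]
    by (intro frac_le power_mono) auto
  then have 2: "cmod (f w / (1 - w)\<^sup>2) \<le> M * log_kernel r"
    by (simp add: log_kernel_def)
  have "cmod (cesaro_kernel f w) \<le> cmod (deriv f w / (1 - w)) + cmod (f w / (1 - w)\<^sup>2)"
    unfolding cesaro_kernel_def by (rule norm_triangle_ineq)
  with 1 2 show "cmod (cesaro_kernel f w) \<le> 2 * bloch_norm 1 f * log_kernel (cmod w)"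
    by (simp add: r_def M_def)
qed

section \<open>Dyadic estimate of the integral of the kernel bound\<close>

text \<open>Once the perturbation is below \<open>\<delta>\<close>, the excess of \<open>y\<close>
  over \<open>c\<close> shrinks by the factor \<open>q\<close> at each step. So \<open>y\<close> is
  eventually below \<open>2 * c\<close>, which is \<open>\<epsilon>\<close>.\<close>

lemma tendsto_0_of_recurrence:
  fixes y e :: "nat \<Rightarrow> real"
  assumes q: "0 < q" "q < 1" and y: "\<And>n. 0 \<le> y n"
    and step: "\<And>n. y (Suc n) \<le> q * (y n + e n)" and e: "e \<longlonglongrightarrow> 0"
  shows "y \<longlonglongrightarrow> 0"
proof (rule LIMSEQ_I)
  fix \<epsilon> :: real assume \<epsilon>: "0 < \<epsilon>"
  define c where "c = \<epsilon> / 2"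
  \<comment> \<open>Chosen so that \<open>c\<close> is the fixed point of the map taking
    \<open>x\<close> to \<open>q * (x + \<delta>)\<close>.\<close>
  define \<delta> where "\<delta> = c * (1 - q) / q"
  have "0 < \<delta>" using q \<epsilon> by (simp add: \<delta>_def c_def)
  then obtain N where N: "\<And>n. n \<ge> N \<Longrightarrow> e n < \<delta>"
    using LIMSEQ_D[OF e] by fastforce
  have bound: "y (N + k) \<le> q ^ k * y N + c" for k
  proof (induction k)
    case (Suc k)
    have "y (N + Suc k) \<le> q * (y (N + k) + e (N + k))" using step[of "N + k"] by simp
    also have "\<dots> \<le> q * (q ^ k * y N + c + \<delta>)"
      using q Suc N[of "N + k"] by (intro mult_left_mono) auto
    also have "\<dots> = q ^ Suc k * y N + c"
      using q by (simp add: \<delta>_def field_simps)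
    finally show ?case .
  qed (use \<epsilon> in \<open>simp add: c_def\<close>)
  have "(\<lambda>k. q ^ k * y N) \<longlonglongrightarrow> 0"
    using q by (intro tendsto_mult_left_zero LIMSEQ_power_zero) auto
  then obtain K where K: "\<And>k. k \<ge> K \<Longrightarrow> q ^ k * y N < c"
    using LIMSEQ_D[of _ 0 c] \<epsilon> unfolding c_def by fastforce
  have "norm (y n - 0) < \<epsilon>" if "n \<ge> N + K" for n
  proof -
    have "K \<le> n - N" "N + (n - N) = n" using that by auto
    then show ?thesis
      using bound[of "n - N"] K[of "n - N"] y[of n] by (simp add: c_def)
  qed
  then show "\<exists>n0. \<forall>n\<ge>n0. norm (y n - 0) < \<epsilon>" by blast
qed

text \<open>The least \<open>m\<close> with \<open>(1/2) ^ m < x\<close> is positive because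
  \<open>x \<le> 1\<close>; its predecessor is the desired index.\<close>

lemma dyadic_bracket:
  fixes x :: real
  assumes "0 < x" "x \<le> 1"
  obtains n where "(1/2) ^ Suc n < x" "x \<le> (1/2) ^ n"
proof -
  define m where "m = (LEAST m. (1/2) ^ m < x)"
  have "\<exists>m. (1/2) ^ m < x" using assms by (intro real_arch_pow_inv) auto
  then have m: "(1/2) ^ m < x" unfolding m_def by (rule LeastI_ex)
  then obtain n where n: "m = Suc n" using assms by (cases m) auto
  have "\<not> (1/2) ^ n < x" using not_less_Least[of n "\<lambda>m. (1/2) ^ m < x"] n by (simp add: m_def)
  then show ?thesis using that m n by auto
qed

context unit_interval_measure
begin

definition log_tail :: "real \<Rightarrow> real \<Rightarrow> real" where
  "log_tail \<beta> t = measure \<mu> {t..<1} * ln (exp 1 / (1 - t)) / (1 - t) powr (2 - \<beta>)"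

text \<open>The quantity \<open>J n\<close> of the overview. Stopping the argument at
  \<open>1 - (1/2) ^ n\<close> keeps the integrand bounded; the integral of
  \<open>log_kernel\<close> itself may diverge.\<close>

definition truncated_integral :: "nat \<Rightarrow> real" where
  "truncated_integral n = (\<integral>t. log_kernel (min t (1 - (1/2) ^ n)) \<partial>\<mu>)"

lemma integrable_log_kernel:
  assumes "continuous_on {0..<1} g" "\<And>t. 0 \<le> t \<Longrightarrow> t < 1 \<Longrightarrow> 0 \<le> g t \<and> g t \<le> R" "R < 1"
  shows "integrable \<mu> (\<lambda>t. log_kernel (g t))"
proof (rule integrable_continuous)
  show "continuous_on {0..<1} (\<lambda>t. log_kernel (g t))"
    using assms(2,3) by (intro continuous_on_compose2[OF continuous_on_log_kernel assms(1)]) force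
  show "norm (log_kernel (g t)) \<le> log_kernel R" if "0 \<le> t" "t < 1" for t
    using assms(2)[OF that] assms(3) log_kernel_nonneg[of "g t"] log_kernel_mono[of "g t" R] by auto
qed

lemma integrable_truncated: "integrable \<mu> (\<lambda>t. log_kernel (min t (1 - (1/2) ^ n)))"
  by (rule integrable_log_kernel[where R="1 - (1/2) ^ n"])
    (auto intro!: continuous_intros simp: power_le_one)

lemma truncated_integral_nonneg: "0 \<le> truncated_integral n"
  unfolding truncated_integral_def
  by (rule Bochner_Integration.integral_nonneg) (auto simp: space_eq power_le_one intro!: log_kernel_nonneg)

text \<open>To the left of \<open>1 - (1/2) ^ n\<close> both integrands agree. To the right the new
  one is at most its final value and the old one is nonnegative.\<close>

lemma truncated_integral_Suc_le:
  "truncated_integral (Suc n) \<le> truncated_integral n +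
     log_kernel (1 - (1/2) ^ Suc n) * measure \<mu> {1 - (1/2) ^ n..<1}"
proof -
  let ?a = "1 - (1/2) ^ n :: real" and ?b = "1 - (1/2) ^ Suc n :: real"
  have ab: "0 \<le> ?a" "?a \<le> ?b" "?b < 1" by (auto simp: power_le_one)
  have meas: "{?a..<1} \<in> sets \<mu>" using ab(1) by (rule tail_measurable)
  have int: "integrable \<mu> (\<lambda>t. log_kernel ?b * indicator {?a..<1} t)"
    using meas by (intro integrable_mult_right integrable_real_indicator) (auto simp: emeasure_eq_measure)
  have "truncated_integral (Suc n) \<le>
      (\<integral>t. log_kernel (min t ?a) + log_kernel ?b * indicator {?a..<1} t \<partial>\<mu>)"
    unfolding truncated_integral_def
  proof (rule integral_mono[OF integrable_truncated
        Bochner_Integration.integrable_add[OF integrable_truncated int]])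
    fix t assume "t \<in> space \<mu>"
    then have t: "0 \<le> t" "t < 1" by (auto simp: space_eq)
    show "log_kernel (min t ?b) \<le> log_kernel (min t ?a) + log_kernel ?b * indicator {?a..<1} t"
    proof (cases "t < ?a")
      case True
      then have "min t ?b = t" "min t ?a = t" using ab(2) by (intro min_absorb1; linarith)+
      then show ?thesis using True by simp
    next
      case False
      then show ?thesis
        using t ab log_kernel_nonneg[of "min t ?a"] log_kernel_mono[of "min t ?b" ?b] by simp
    qed
  qed
  also have "\<dots> = truncated_integral n + log_kernel ?b * measure \<mu> {?a..<1}"
    using int meas sets.sets_into_space[OF meas] unfolding truncated_integral_def
    by (subst Bochner_Integration.integral_add[OF integrable_truncated int]) (simp add: Int_absorb2)
  finally show ?thesis .
qed

text \<open>Replacing \<open>x / 2\<close> by \<open>x\<close> costs a factor 4 in the squared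
  denominator and, because \<open>ln 2 \<le> 1\<close>, at most a factor 2 in the logarithm;
  together 8. What remains is \<open>log_tail\<close>, as \<open>x powr \<beta> / x powr 2\<close>
  is the reciprocal of \<open>x powr (2 - \<beta>)\<close> and \<open>1 - ln x\<close> is
  \<open>ln (exp 1 / x)\<close>.\<close>

lemma log_kernel_times_tail_le:
  assumes x: "0 < x" "x \<le> 1"
  shows "x powr \<beta> * (log_kernel (1 - x/2) * measure \<mu> {1 - x..<1}) \<le> 8 * log_tail \<beta> (1 - x)"
proof -
  have lnx: "ln x \<le> 0" using x by simp
  have ln2: "ln (2::real) \<le> 1" using ln_le_minus_one[of 2] by simp
  have "1 - (a - b) \<le> 2 * (1 - a)" if "b \<le> 1" "a \<le> 0" for a b :: real
    using that by (simp add: algebra_simps)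
  from this[OF ln2 lnx] have "1 - ln (x / 2) \<le> 2 * (1 - ln x)" using x(1) by (simp add: ln_div)
  then have "log_kernel (1 - x / 2) \<le> 2 * (1 - ln x) / (x / 2)\<^sup>2"
    unfolding log_kernel_def by (simp add: divide_right_mono)
  also have "\<dots> = 8 * (1 - ln x) / x\<^sup>2" by (simp add: power_divide)
  finally have k: "log_kernel (1 - x / 2) \<le> 8 * (1 - ln x) / x\<^sup>2" .
  have "x powr \<beta> * (log_kernel (1 - x/2) * measure \<mu> {1 - x..<1}) \<le>
      x powr \<beta> * (8 * (1 - ln x) / x\<^sup>2 * measure \<mu> {1 - x..<1})"
    by (intro mult_left_mono mult_right_mono k) auto
  also have "\<dots> = 8 * (measure \<mu> {1 - x..<1} * (1 - ln x) * (x powr \<beta> / x powr 2))"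
    using x by simp
  also have "x powr \<beta> / x powr 2 = 1 / x powr (2 - \<beta>)"
    using x by (simp add: powr_diff)
  finally show ?thesis using x by (simp add: log_tail_def ln_div)
qed

text \<open>Passing from \<open>n\<close> to \<open>n + 1\<close> multiplies the weight by
  \<open>(1/2) powr \<beta>\<close>, which is below 1 as \<open>\<beta>\<close> is positive. The
  increment estimate then becomes a contracting recurrence whose perturbation is a multiple of
  \<open>log_tail\<close> at \<open>1 - (1/2) ^ n\<close>.\<close>

lemma truncated_integral_limit:
  assumes \<beta>: "0 < \<beta>" and lim: "(log_tail \<beta> \<longlongrightarrow> 0) (at_left 1)"
  shows "(\<lambda>n. ((1/2) ^ n) powr \<beta> * truncated_integral n) \<longlonglongrightarrow> 0"
proof (rule tendsto_0_of_recurrence[where q="(1/2) powr \<beta>" and e="\<lambda>n. 8 * log_tail \<beta> (1 - (1/2) ^ n)"])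
  show "(1/2) powr \<beta> < (1::real)" using \<beta> by (simp add: powr_def ln_div)
  show "0 \<le> ((1/2) ^ n) powr \<beta> * truncated_integral n" for n
    by (simp add: truncated_integral_nonneg)
  have "filterlim (\<lambda>n. 1 - (1/2) ^ n :: real) (at_left 1) sequentially"
  proof (rule tendsto_imp_filterlim_at_left)
    show "(\<lambda>n. 1 - (1/2) ^ n :: real) \<longlonglongrightarrow> 1"
      using tendsto_diff[OF tendsto_const LIMSEQ_power_zero[of "1/2::real"], of 1] by simp
  qed auto
  then have "(\<lambda>n. log_tail \<beta> (1 - (1/2) ^ n)) \<longlonglongrightarrow> 0"
    by (rule filterlim_compose[OF lim])
  then show "(\<lambda>n. 8 * log_tail \<beta> (1 - (1/2) ^ n)) \<longlonglongrightarrow> 0"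
    by (rule tendsto_mult_right_zero)
  show "((1/2) ^ Suc n) powr \<beta> * truncated_integral (Suc n) \<le>
    (1/2) powr \<beta> * (((1/2) ^ n) powr \<beta> * truncated_integral n + 8 * log_tail \<beta> (1 - (1/2) ^ n))" for n
  proof -
    define x :: real where "x = (1/2) ^ n"
    have x: "0 < x" "x \<le> 1" by (auto simp: x_def power_le_one)
    have "((1/2) ^ Suc n) powr \<beta> * truncated_integral (Suc n) =
        (1/2) powr \<beta> * (x powr \<beta> * truncated_integral (Suc n))"
      unfolding x_def power_Suc by (subst powr_mult) auto
    also have "\<dots> \<le> (1/2) powr \<beta> * (x powr \<beta> *
        (truncated_integral n + log_kernel (1 - x/2) * measure \<mu> {1 - x..<1}))"
      using truncated_integral_Suc_le[of n] by (intro mult_left_mono) (auto simp: x_def)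
    also have "\<dots> \<le> (1/2) powr \<beta> * (x powr \<beta> * truncated_integral n + 8 * log_tail \<beta> (1 - x))"
      using log_kernel_times_tail_le[OF x, of \<beta>] by (intro mult_left_mono) (auto simp: distrib_left)
    finally show ?thesis by (simp add: x_def)
  qed
qed simp

text \<open>For \<open>r\<close> with \<open>1 - r\<close> between \<open>(1/2) ^ Suc n\<close> and
  \<open>(1/2) ^ n\<close>, the product \<open>t * r\<close> is at most both \<open>t\<close> and
  \<open>1 - (1/2) ^ Suc n\<close>, so monotonicity of \<open>log_kernel\<close> bounds the integral
  by a truncated one.\<close>

lemma integral_log_kernel_limit:
  assumes \<beta>: "0 < \<beta>" and lim: "(log_tail \<beta> \<longlongrightarrow> 0) (at_left 1)" and \<epsilon>: "0 < \<epsilon>"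
  obtains R where "0 \<le> R" "R < 1"
    "\<And>r. R \<le> r \<Longrightarrow> r < 1 \<Longrightarrow> (1 - r) powr \<beta> * (\<integral>t. log_kernel (t * r) \<partial>\<mu>) \<le> \<epsilon>"
proof -
  \<comment> \<open>The weight of level \<open>n\<close> meets the truncated integral of level
    \<open>n + 1\<close>; the divisor \<open>2 powr \<beta>\<close> pays for this shift.\<close>
  have "0 < \<epsilon> / 2 powr \<beta>" using \<epsilon> by simp
  then obtain N where N: "\<And>n. n \<ge> N \<Longrightarrow> ((1/2) ^ n) powr \<beta> * truncated_integral n < \<epsilon> / 2 powr \<beta>"
    using LIMSEQ_D[OF truncated_integral_limit[OF \<beta> lim]] by fastforce
  show thesis
  proof
    show "0 \<le> 1 - (1/2::real) ^ N" "1 - (1/2::real) ^ N < 1" by (auto simp: power_le_one)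
    fix r :: real assume r: "1 - (1/2) ^ N \<le> r" "r < 1"
    have r0: "0 \<le> r" using r(1) power_le_one[of "1/2::real" N] by linarith
    obtain n where n: "(1/2) ^ Suc n < 1 - r" "1 - r \<le> (1/2) ^ n"
      using dyadic_bracket[of "1 - r"] r r0 by auto
    have "(1/2::real) ^ Suc n < (1/2) ^ N" using n r by linarith
    then have "N < Suc n" by (subst (asm) power_strict_decreasing_iff) auto
    then have "((1/2) ^ Suc n) powr \<beta> * truncated_integral (Suc n) \<le> \<epsilon> / 2 powr \<beta>"
      using N[of "Suc n"] by simp
    moreover have "((1/2::real) ^ Suc n) powr \<beta> = ((1/2) ^ n) powr \<beta> / 2 powr \<beta>"
      unfolding power_Suc by (subst powr_mult) (auto simp: powr_divide)
    ultimately have J: "((1/2) ^ n) powr \<beta> * truncated_integral (Suc n) \<le> \<epsilon>"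
      by (simp add: divide_le_cancel)
    have "(\<integral>t. log_kernel (t * r) \<partial>\<mu>) \<le> truncated_integral (Suc n)"
      unfolding truncated_integral_def
    proof (rule integral_mono[OF _ integrable_truncated])
      have tr: "t * r \<le> r" "t * r \<le> t" if "0 \<le> t" "t < 1" for t
        using that r r0 by (auto intro: mult_left_le_one_le mult_left_le)
      show "integrable \<mu> (\<lambda>t. log_kernel (t * r))"
        using r r0 tr by (intro integrable_log_kernel[where R=r]) (auto intro!: continuous_intros)
      fix t assume "t \<in> space \<mu>"
      then show "log_kernel (t * r) \<le> log_kernel (min t (1 - (1/2) ^ Suc n))"
        using tr[of t] r0 n by (intro log_kernel_mono) (auto simp: space_eq)
    qed
    moreover have "(1 - r) powr \<beta> \<le> ((1/2) ^ n) powr \<beta>"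
      using n r \<beta> by (intro powr_mono2) auto
    ultimately have "(1 - r) powr \<beta> * (\<integral>t. log_kernel (t * r) \<partial>\<mu>) \<le>
        ((1/2) ^ n) powr \<beta> * truncated_integral (Suc n)"
      using truncated_integral_nonneg[of "Suc n"]
      by (meson mult_left_mono mult_right_mono order_trans powr_ge_zero)
    with J show "(1 - r) powr \<beta> * (\<integral>t. log_kernel (t * r) \<partial>\<mu>) \<le> \<epsilon>" by linarith
  qed
qed

end

section \<open>Compactness from the tail condition\<close>

lemma zero_in_bloch: "(\<lambda>_. 0) \<in> bloch \<alpha>"
  by (rule blochI[where B=0]) (auto simp: analytic_disc_def)

lemma deriv_diff_disc:
  assumes "f holomorphic_on unit_disc" "g holomorphic_on unit_disc" "cmod z < 1"
  shows "deriv (\<lambda>z. f z - g z) z = deriv f z - deriv g z"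
  using assms by (intro deriv_diff holomorphic_on_imp_differentiable_at[where s=unit_disc]) auto

lemma bloch_diff:
  assumes f: "f \<in> bloch \<alpha>" and g: "g \<in> bloch \<alpha>"
  shows "(\<lambda>z. f z - g z) \<in> bloch \<alpha>"
proof (rule blochI)
  show "(\<lambda>z. f z - g z) \<in> analytic_disc"
    using f g by (auto simp: bloch_def analytic_disc_def intro: holomorphic_intros)
  fix z :: complex assume z: "cmod z < 1"
  have "(1 - (cmod z)\<^sup>2) powr \<alpha> * cmod (deriv (\<lambda>z. f z - g z) z) \<le>
      (1 - (cmod z)\<^sup>2) powr \<alpha> * (cmod (deriv f z) + cmod (deriv g z))"
    unfolding deriv_diff_disc[OF bloch_holomorphic[OF f] bloch_holomorphic[OF g] z]
    by (intro mult_left_mono norm_triangle_ineq4) simp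
  also have "\<dots> \<le> bloch_norm \<alpha> f + bloch_norm \<alpha> g"
    using bloch_deriv_le[OF f z] bloch_deriv_le[OF g z] norm_ge_zero[of "f 0"] norm_ge_zero[of "g 0"]
    unfolding distrib_left by linarith
  finally show "(1 - (cmod z)\<^sup>2) powr \<alpha> * cmod (deriv (\<lambda>z. f z - g z) z) \<le>
      bloch_norm \<alpha> f + bloch_norm \<alpha> g" .
qed

lemma bloch_dist_0: "f \<in> bloch \<alpha> \<Longrightarrow> bloch_dist \<alpha> f (\<lambda>_. 0) = bloch_norm \<alpha> f"
  by (simp add: bloch_dist_def zero_in_bloch)

text \<open>A bounded set lies in a ball about some centre; the triangle inequality moves the centre
  to the zero function, where distance is the norm.\<close>

lemma mbounded_bloch_iff:
  "Metric_space.mbounded (bloch \<alpha>) (bloch_dist \<alpha>) S \<longleftrightarrow>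
     S \<subseteq> bloch \<alpha> \<and> (\<exists>M. \<forall>f\<in>S. bloch_norm \<alpha> f \<le> M)"
proof -
  interpret Metric_space "bloch \<alpha>" "bloch_dist \<alpha>" by (rule Metric_space_bloch)
  show ?thesis
  proof
    assume "mbounded S"
    then obtain x B where x: "S \<subseteq> mcball x B" by (auto simp: mbounded_def)
    have "bloch_norm \<alpha> f \<le> B + bloch_norm \<alpha> x" if "f \<in> S" for f
      using that x triangle[of f x "\<lambda>_. 0"] commute[of f x]
      by (auto simp: in_mcball bloch_dist_0 zero_in_bloch subset_iff)
    then show "S \<subseteq> bloch \<alpha> \<and> (\<exists>M. \<forall>f\<in>S. bloch_norm \<alpha> f \<le> M)"
      using mbounded_subset_mspace[OF \<open>mbounded S\<close>] by blast
  next
    assume "S \<subseteq> bloch \<alpha> \<and> (\<exists>M. \<forall>f\<in>S. bloch_norm \<alpha> f \<le> M)"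
    then show "mbounded S"
      unfolding mbounded
      by (metis bloch_dist_0 commute subsetD zero_in_bloch)
  qed
qed

text \<open>Bolzano-Weierstrass twice: relative compactness means that infinite subsets of
  \<open>S\<close> have limit points, and this means that sequences in \<open>S\<close> have
  convergent subsequences. The limits may lie anywhere in \<open>M\<close>.\<close>

lemma (in Metric_space) compact_closure_iff_sequential:
  assumes "S \<subseteq> M"
  shows "compactin mtopology (mtopology closure_of S) \<longleftrightarrow>
    (\<forall>\<sigma>::nat \<Rightarrow> 'a. range \<sigma> \<subseteq> S \<longrightarrow>
      (\<exists>l r. l \<in> M \<and> strict_mono r \<and> limitin mtopology (\<sigma> \<circ> r) l sequentially))"
proof -
  have "mtopology derived_set_of T \<subseteq> M" for T
    using derived_set_of_subset_topspace[of mtopology T] by simp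
  then show ?thesis
    unfolding compact_closure_of_eq_Bolzano_Weierstrass Bolzano_Weierstrass_property[OF assms assms]
    using assms by (metis Int_absorb1 subset_trans)
qed

section \<open>Cauchy estimates and normal families\<close>

text \<open>The kernel is the derivative of \<open>g v / (1 - v)\<close>, so Cauchy's inequality on
  the circle of radius \<open>R' - R\<close> about \<open>w\<close> bounds it by the size of
  \<open>g\<close> alone; on that circle \<open>cmod (1 - v)\<close> is at least
  \<open>1 - R'\<close>.\<close>

lemma cesaro_kernel_Cauchy_bound:
  assumes g: "g holomorphic_on unit_disc" and R: "R < R'" "R' < 1" and w: "cmod w \<le> R"
    and \<delta>: "\<And>v. cmod v \<le> R' \<Longrightarrow> cmod (g v) \<le> \<delta>"
  shows "cmod (cesaro_kernel g w) \<le> \<delta> / (1 - R') / (R' - R)"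
proof -
  let ?G = "\<lambda>v. g v / (1 - v)"
  have sub: "cball w (R' - R) \<subseteq> cball 0 R'"
  proof
    fix v assume "v \<in> cball w (R' - R)"
    then have "cmod (v - w) \<le> R' - R" by (simp add: dist_norm norm_minus_commute)
    then show "v \<in> cball 0 R'" using norm_triangle_ineq[of w "v - w"] w by simp
  qed
  have G: "?G holomorphic_on unit_disc"
    using g by (intro holomorphic_intros) auto
  have subd: "cball w (R' - R) \<subseteq> unit_disc" using sub R by force
  have "cmod ((deriv ^^ 1) ?G w) \<le> fact 1 * (\<delta> / (1 - R')) / (R' - R) ^ 1"
  proof (rule Cauchy_inequality)
    show "?G holomorphic_on ball w (R' - R)"
      using G subd by (meson ball_subset_cball holomorphic_on_subset subset_trans)
    show "continuous_on (cball w (R' - R)) ?G"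
      using G subd holomorphic_on_imp_continuous_on continuous_on_subset by blast
    show "0 < R' - R" using R by simp
    fix v assume "cmod (w - v) = R' - R"
    then have "v \<in> cball w (R' - R)" by (simp add: dist_norm)
    then have v: "cmod v \<le> R'" using sub by auto
    have "1 - R' \<le> cmod (1 - v)" using norm_triangle_ineq2[of 1 v] v by simp
    moreover have "0 \<le> \<delta>" using \<delta>[OF v] norm_ge_zero order_trans by blast
    ultimately show "cmod (?G v) \<le> \<delta> / (1 - R')"
      unfolding norm_divide using \<delta>[OF v] R by (intro frac_le) auto
  qed
  moreover have "deriv ?G w = cesaro_kernel g w"
    unfolding cesaro_kernel_def using w R by (intro DERIV_imp_deriv quotient_field_derivative g) simp
  ultimately show ?thesis by simp
qed

lemma holomorphic_zero_extension:
  assumes "g holomorphic_on unit_disc"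
  shows "(\<lambda>z. if z \<in> unit_disc then g z else 0) \<in> analytic_disc"
proof -
  have "(\<lambda>z. if z \<in> unit_disc then g z else 0) holomorphic_on unit_disc"
    using assms by (rule holomorphic_transform) simp
  then show ?thesis by (simp add: analytic_disc_def)
qed

text \<open>The logarithmic growth bound makes the sequence locally uniformly bounded, so Montel's
  theorem applies. Derivatives converge along with the functions, hence the bound \<open>M\<close>
  on the weighted derivative passes to the limit.\<close>

lemma Montel_bloch:
  assumes f: "\<And>n. f n \<in> bloch 1" "\<And>n. bloch_norm 1 (f n) \<le> M"
  obtains g and r :: "nat \<Rightarrow> nat" where "g \<in> bloch 1" "strict_mono r"
    "\<And>R. R < 1 \<Longrightarrow> uniform_limit (cball 0 R) (\<lambda>n. f (r n)) g sequentially"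
proof -
  have M: "0 \<le> M" using norm_0_le_bloch_norm[OF f(1)] f(2) by (meson norm_ge_zero order_trans)
  obtain g0 and r :: "nat \<Rightarrow> nat" where g0: "g0 holomorphic_on unit_disc" and r: "strict_mono r"
    and lim0: "\<And>K. compact K \<Longrightarrow> K \<subseteq> unit_disc \<Longrightarrow> uniform_limit K (f \<circ> r) g0 sequentially"
  proof (rule Montel[OF open_ball, of "{h \<in> bloch 1. bloch_norm 1 h \<le> M}" 0 1 f])
    show "range f \<subseteq> {h \<in> bloch 1. bloch_norm 1 h \<le> M}" using f by auto
    show "h holomorphic_on unit_disc" if "h \<in> {h \<in> bloch 1. bloch_norm 1 h \<le> M}" for h
      using that by (auto intro: bloch_holomorphic)
    fix K :: "complex set" assume K: "compact K" "K \<subseteq> unit_disc"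
    have "continuous_on K (\<lambda>w. M * (1 - ln (1 - cmod w)))"
      using K by (intro continuous_intros) auto
    then have "bounded ((\<lambda>w. M * (1 - ln (1 - cmod w))) ` K)"
      using K by (intro compact_imp_bounded compact_continuous_image)
    then obtain B where B: "\<And>w. w \<in> K \<Longrightarrow> M * (1 - ln (1 - cmod w)) \<le> B"
      using bounded_imp_bdd_above unfolding bdd_above_def by fast
    have "cmod (h w) \<le> B" if h: "h \<in> bloch 1" "bloch_norm 1 h \<le> M" and w: "w \<in> K" for h w
    proof -
      have w1: "cmod w < 1" using K w by auto
      have "1 - ln (1 - cmod w) \<ge> 0"
        using ln_le_minus_one[of "1 - cmod w"] w1 norm_ge_zero[of w] by linarith
      then show ?thesis
        using bloch_growth[OF h(1) w1] mult_right_mono[OF h(2)] B[OF w] by (meson order_trans)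
    qed
    then show "\<exists>B. \<forall>h\<in>{h \<in> bloch 1. bloch_norm 1 h \<le> M}. \<forall>z\<in>K. cmod (h z) \<le> B"
      by blast
  qed metis
  \<comment> \<open>The limit from Montel's theorem is arbitrary off the disc; it is reset to 0
    there to become a member of \<open>analytic_disc\<close>.\<close>
  define g where "g = (\<lambda>z. if z \<in> unit_disc then g0 z else 0)"
  have g: "g \<in> analytic_disc"
    unfolding g_def using g0 by (rule holomorphic_zero_extension)
  have lim: "uniform_limit K (\<lambda>n. f (r n)) g sequentially" if "compact K" "K \<subseteq> unit_disc" for K
    using lim0[OF that] that by (subst uniform_limit_cong'[where g="f \<circ> r" and i=g0]) (auto simp: g_def)
  have "g \<in> bloch 1"
  proof (rule blochI[OF g])
    fix z :: complex assume z: "cmod z < 1"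
    define R where "R = (1 + cmod z) / 2"
    have R: "cmod z < R" "R < 1" using z by (auto simp: R_def)
    have "uniform_limit (ball 0 R) (\<lambda>n. f (r n)) g sequentially"
      using R by (intro uniform_limit_on_subset[OF lim[of "cball 0 R"]]) auto
    moreover have "\<forall>\<^sub>F n in sequentially. f (r n) holomorphic_on ball 0 R"
      using R by (intro always_eventually allI holomorphic_on_subset[OF bloch_holomorphic[OF f(1)]]) auto
    ultimately have "(\<lambda>n. (deriv ^^ 1) (f (r n)) z) \<longlonglongrightarrow> (deriv ^^ 1) g z"
      using R by (intro higher_deriv_complex_uniform_limit) auto
    then have "(\<lambda>n. (1 - (cmod z)\<^sup>2) powr 1 * cmod (deriv (f (r n)) z)) \<longlonglongrightarrow>
        (1 - (cmod z)\<^sup>2) powr 1 * cmod (deriv g z)"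
      by (intro tendsto_intros) simp
    moreover have "(1 - (cmod z)\<^sup>2) powr 1 * cmod (deriv (f (r n)) z) \<le> M" for n
      using bloch_deriv_le[OF f(1) z] f(2)[of "r n"] norm_ge_zero[of "f (r n) 0"]
      by (meson diff_le_eq le_add_same_cancel1 order_trans)
    ultimately show "(1 - (cmod z)\<^sup>2) powr 1 * cmod (deriv g z) \<le> M"
      by (intro LIMSEQ_le_const2) auto
  qed
  then show thesis
    by (rule that[OF _ r lim]) auto
qed

section \<open>Boundary and interior estimates for the image\<close>

context unit_interval_measure
begin

text \<open>The finer estimate for the region near the boundary: the kernel bound stays under the
  integral, where the decay of \<open>\<mu>\<close> near 1 can compensate its blow-up.\<close>

lemma norm_deriv_cesaro_like_le_integral:
  assumes f: "f \<in> bloch 1" and z: "cmod z < 1"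
  shows "cmod (deriv (cesaro_like \<mu> f) z) \<le> 2 * bloch_norm 1 f * (\<integral>t. log_kernel (t * cmod z) \<partial>\<mu>)"
proof -
  have tz: "t * cmod z \<le> cmod z" "0 \<le> t * cmod z" if "0 \<le> t" "t < 1" for t
    using that by (auto intro: mult_left_le_one_le)
  have hol: "f holomorphic_on unit_disc" using f by (rule bloch_holomorphic)
  have int: "integrable \<mu> (\<lambda>t. log_kernel (t * cmod z))"
    using tz z by (intro integrable_log_kernel[where R="cmod z"]) (auto intro!: continuous_intros)
  have "cmod (deriv (cesaro_like \<mu> f) z) \<le> (\<integral>t. 2 * bloch_norm 1 f * log_kernel (t * cmod z) \<partial>\<mu>)"
    unfolding deriv_cesaro_like[OF hol z]
  proof (rule Bochner_Integration.integral_norm_bound_integral)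
    show "integrable \<mu> (\<lambda>t. of_real t * cesaro_kernel f (of_real t * z))"
      by (intro integrable_dilation cesaro_kernel_holomorphic hol z)
    show "integrable \<mu> (\<lambda>t. 2 * bloch_norm 1 f * log_kernel (t * cmod z))"
      using int by (rule integrable_mult_right)
    fix t assume "t \<in> space \<mu>"
    then have t: "0 \<le> t" "t < 1" by (auto simp: space_eq)
    then have "cmod (of_real t * cesaro_kernel f (of_real t * z)) \<le> cmod (cesaro_kernel f (of_real t * z))"
      by (simp add: norm_mult mult_left_le_one_le)
    also have "\<dots> \<le> 2 * bloch_norm 1 f * log_kernel (t * cmod z)"
      using cesaro_kernel_le[OF f of_real_times_in_disc(2)[OF t z]] t by (simp add: norm_mult)
    finally show "cmod (of_real t * cesaro_kernel f (of_real t * z)) \<le>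
        2 * bloch_norm 1 f * log_kernel (t * cmod z)" .
  qed
  then show ?thesis by simp
qed

text \<open>The radius \<open>R\<close> depends on \<open>\<epsilon>\<close> but not on
  \<open>f\<close>. This uniformity on bounded sets is what turns boundedness into
  compactness.\<close>

lemma weighted_deriv_cesaro_like_le:
  assumes \<beta>: "0 < \<beta>" and lim: "(log_tail \<beta> \<longlongrightarrow> 0) (at_left 1)" and \<epsilon>: "0 < \<epsilon>"
  obtains R where "0 \<le> R" "R < 1"
    "\<And>f z. f \<in> bloch 1 \<Longrightarrow> R \<le> cmod z \<Longrightarrow> cmod z < 1 \<Longrightarrow>
      (1 - (cmod z)\<^sup>2) powr \<beta> * cmod (deriv (cesaro_like \<mu> f) z) \<le> \<epsilon> * bloch_norm 1 f"
proof -
  \<comment> \<open>Absorbs the factor 2 of the kernel bound and the factor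
    \<open>2 powr \<beta>\<close> from
    \<open>1 - (cmod z)\<^sup>2 \<le> 2 * (1 - cmod z)\<close>.\<close>
  define \<delta> where "\<delta> = \<epsilon> / (2 * 2 powr \<beta>)"
  have "0 < \<delta>" using \<epsilon> by (simp add: \<delta>_def)
  from integral_log_kernel_limit[OF \<beta> lim this]
  obtain R where R: "0 \<le> R" "R < 1"
    "\<And>r. R \<le> r \<Longrightarrow> r < 1 \<Longrightarrow> (1 - r) powr \<beta> * (\<integral>t. log_kernel (t * r) \<partial>\<mu>) \<le> \<delta>"
    by metis
  show thesis
  proof (rule that[OF R(1,2)])
    fix f z assume f: "f \<in> bloch 1" and z: "R \<le> cmod z" "cmod z < 1"
    let ?M = "bloch_norm 1 f"
    have M: "0 \<le> ?M" using norm_0_le_bloch_norm[OF f] norm_ge_zero order_trans by blast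
    have "(1 - (cmod z)\<^sup>2) powr \<beta> \<le> (2 * (1 - cmod z)) powr \<beta>"
      using one_minus_norm_le[OF z(2)] z \<beta> by (intro powr_mono2) auto
    also have "\<dots> = 2 powr \<beta> * (1 - cmod z) powr \<beta>" using z by (intro powr_mult)
    finally have weight: "(1 - (cmod z)\<^sup>2) powr \<beta> \<le> 2 powr \<beta> * (1 - cmod z) powr \<beta>" .
    have "(1 - (cmod z)\<^sup>2) powr \<beta> * cmod (deriv (cesaro_like \<mu> f) z) \<le>
        (2 powr \<beta> * (1 - cmod z) powr \<beta>) * (2 * ?M * (\<integral>t. log_kernel (t * cmod z) \<partial>\<mu>))"
      using weight norm_deriv_cesaro_like_le_integral[OF f z(2)] by (intro mult_mono) auto
    also have "\<dots> = (2 * 2 powr \<beta> * ?M) * ((1 - cmod z) powr \<beta> * (\<integral>t. log_kernel (t * cmod z) \<partial>\<mu>))"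
      by simp
    also have "\<dots> \<le> (2 * 2 powr \<beta> * ?M) * \<delta>"
      using R(3)[OF z] M by (intro mult_left_mono) auto
    also have "\<dots> = \<epsilon> * ?M" by (simp add: \<delta>_def)
    finally show "(1 - (cmod z)\<^sup>2) powr \<beta> * cmod (deriv (cesaro_like \<mu> f) z) \<le> \<epsilon> * ?M" .
  qed
qed

lemma weight_le_1:
  assumes "cmod z < 1" "0 < \<beta>"
  shows "(1 - (cmod z)\<^sup>2) powr \<beta> \<le> 1"
proof -
  have "(cmod z)\<^sup>2 < 1" using assms by (simp add: abs_square_less_1)
  then show ?thesis using assms by (intro powr_le1) auto
qed

lemma cesaro_like_maps_bloch:
  assumes \<beta>: "0 < \<beta>" and lim: "(log_tail \<beta> \<longlongrightarrow> 0) (at_left 1)" and f: "f \<in> bloch 1"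
  shows "cesaro_like \<mu> f \<in> bloch \<beta>"
proof -
  have hol: "f holomorphic_on unit_disc" using f by (rule bloch_holomorphic)
  obtain R where R: "0 \<le> R" "R < 1" and outer:
    "\<And>f z. f \<in> bloch 1 \<Longrightarrow> R \<le> cmod z \<Longrightarrow> cmod z < 1 \<Longrightarrow>
      (1 - (cmod z)\<^sup>2) powr \<beta> * cmod (deriv (cesaro_like \<mu> f) z) \<le> 1 * bloch_norm 1 f"
    using weighted_deriv_cesaro_like_le[OF \<beta> lim zero_less_one] by metis
  have M: "0 \<le> bloch_norm 1 f" using norm_0_le_bloch_norm[OF f] norm_ge_zero order_trans by blast
  let ?B = "2 * bloch_norm 1 f * log_kernel R * measure \<mu> (space \<mu>)"
  have B0: "0 \<le> ?B" using M R log_kernel_nonneg[of R] by simp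
  show ?thesis
  proof (rule blochI[OF cesaro_like_analytic[OF hol]])
    fix z :: complex assume z: "cmod z < 1"
    show "(1 - (cmod z)\<^sup>2) powr \<beta> * cmod (deriv (cesaro_like \<mu> f) z) \<le> bloch_norm 1 f + ?B"
    proof (cases "R \<le> cmod z")
      case True
      then show ?thesis using outer[OF f True z] B0 by linarith
    next
      case False
      have "cmod (cesaro_kernel f w) \<le> 2 * bloch_norm 1 f * log_kernel R" if "cmod w \<le> cmod z" for w
        using cesaro_kernel_le[OF f, of w] log_kernel_mono[of "cmod w" R] that False R z M
          mult_left_mono[of "log_kernel (cmod w)" "log_kernel R" "2 * bloch_norm 1 f"] by simp
      then have "cmod (deriv (cesaro_like \<mu> f) z) \<le> ?B"
        by (rule norm_deriv_cesaro_like_le[OF hol z])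
      then have "(1 - (cmod z)\<^sup>2) powr \<beta> * cmod (deriv (cesaro_like \<mu> f) z) \<le> 1 * ?B"
        using weight_le_1[OF z \<beta>] by (intro mult_mono) auto
      then show ?thesis using M by simp
    qed
  qed
qed

text \<open>Near the boundary the weighted derivative is small because the norms are bounded; in the
  disc of radius \<open>R\<close> it is small by Cauchy's inequality from uniform convergence on a
  larger disc; at 0 the image is the total mass times \<open>g n 0\<close>.\<close>

lemma cesaro_like_null_sequence:
  assumes \<beta>: "0 < \<beta>" and lim: "(log_tail \<beta> \<longlongrightarrow> 0) (at_left 1)"
    and g: "\<And>n. g n \<in> bloch 1" "\<And>n. bloch_norm 1 (g n) \<le> M"
    and unif: "\<And>R. R < 1 \<Longrightarrow> uniform_limit (cball 0 R) g (\<lambda>_. 0) sequentially"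
  shows "(\<lambda>n. bloch_norm \<beta> (cesaro_like \<mu> (g n))) \<longlonglongrightarrow> 0"
proof (rule LIMSEQ_I)
  fix \<epsilon> :: real assume \<epsilon>: "0 < \<epsilon>"
  have hol: "g n holomorphic_on unit_disc" for n using g(1) by (rule bloch_holomorphic)
  have M: "0 \<le> M" using norm_0_le_bloch_norm[OF g(1)] g(2) by (meson norm_ge_zero order_trans)
  \<comment> \<open>Dividing by \<open>M + 1\<close> also covers \<open>M = 0\<close>;
    \<open>m\<close> below exceeds the total mass by 1 for the same reason.\<close>
  define \<epsilon>' where "\<epsilon>' = \<epsilon> / 4 / (M + 1)"
  have \<epsilon>': "0 < \<epsilon>'" using \<epsilon> M by (simp add: \<epsilon>'_def)
  from weighted_deriv_cesaro_like_le[OF \<beta> lim \<epsilon>']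
  obtain R where R: "0 \<le> R" "R < 1" and outer:
    "\<And>f z. f \<in> bloch 1 \<Longrightarrow> R \<le> cmod z \<Longrightarrow> cmod z < 1 \<Longrightarrow>
      (1 - (cmod z)\<^sup>2) powr \<beta> * cmod (deriv (cesaro_like \<mu> f) z) \<le> \<epsilon>' * bloch_norm 1 f"
    by metis
  have \<epsilon>'M: "\<epsilon>' * bloch_norm 1 (g n) \<le> \<epsilon> / 4" for n
  proof -
    have "\<epsilon>' * bloch_norm 1 (g n) \<le> \<epsilon>' * (M + 1)"
      using g(2)[of n] \<epsilon>' by (intro mult_left_mono) auto
    moreover have "\<epsilon>' * (M + 1) = \<epsilon> / 4"
      using M unfolding \<epsilon>'_def by (intro nonzero_divide_eq_eq[THEN iffD1, OF _ refl, symmetric]) auto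
    ultimately show ?thesis by simp
  qed
  define R' where "R' = (1 + R) / 2"
  have R': "R < R'" "R' < 1" using R by (auto simp: R'_def)
  define m where "m = measure \<mu> (space \<mu>) + 1"
  have m: "0 < m" "measure \<mu> (space \<mu>) \<le> m" by (auto simp: m_def add_nonneg_pos)
  \<comment> \<open>The factors \<open>R' - R\<close> and \<open>1 - R'\<close> cancel the
    denominators of the Cauchy bound and leave \<open>\<epsilon> / (4 * m)\<close>. Being at most 1,
    they also give \<open>m * \<delta> \<le> \<epsilon> / 4\<close> for the value at 0.\<close>
  define \<delta> where "\<delta> = \<epsilon> / (4 * m) * (R' - R) * (1 - R')"
  have \<delta>: "0 < \<delta>" using \<epsilon> m R' by (simp add: \<delta>_def)
  have "\<forall>\<^sub>F n in sequentially. \<forall>v\<in>cball 0 R'. dist (g n v) 0 < \<delta>"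
    using unif[OF R'(2)] \<delta> by (rule uniform_limitD)
  then obtain N where N: "\<And>n v. n \<ge> N \<Longrightarrow> cmod v \<le> R' \<Longrightarrow> cmod (g n v) \<le> \<delta>"
    by (force simp: eventually_sequentially less_imp_le)
  have "norm (bloch_norm \<beta> (cesaro_like \<mu> (g n)) - 0) < \<epsilon>" if n: "n \<ge> N" for n
  proof -
    have inner: "cmod (cesaro_kernel (g n) w) \<le> \<epsilon> / (4 * m)" if w: "cmod w \<le> R" for w
      using cesaro_kernel_Cauchy_bound[OF hol R' w N[OF n]] R' by (simp add: \<delta>_def)
    have "bloch_norm \<beta> (cesaro_like \<mu> (g n)) \<le> cmod (cesaro_like \<mu> (g n) 0) + \<epsilon> / 4"
    proof (rule bloch_norm_le[OF cesaro_like_analytic[OF hol]])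
      fix z :: complex assume z: "cmod z < 1"
      show "(1 - (cmod z)\<^sup>2) powr \<beta> * cmod (deriv (cesaro_like \<mu> (g n)) z) \<le> \<epsilon> / 4"
      proof (cases "R \<le> cmod z")
        case True
        then show ?thesis using outer[OF g(1) True z, of n] \<epsilon>'M[of n] by linarith
      next
        case False
        then have "cmod (deriv (cesaro_like \<mu> (g n)) z) \<le> \<epsilon> / (4 * m) * measure \<mu> (space \<mu>)"
          by (intro norm_deriv_cesaro_like_le[OF hol z] inner) auto
        also have "\<dots> \<le> \<epsilon> / (4 * m) * m"
          using m \<epsilon> by (intro mult_left_mono) auto
        also have "\<dots> = \<epsilon> / 4" using m by simp
        finally have "(1 - (cmod z)\<^sup>2) powr \<beta> * cmod (deriv (cesaro_like \<mu> (g n)) z) \<le> 1 * (\<epsilon> / 4)"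
          using weight_le_1[OF z \<beta>] by (intro mult_mono) auto
        then show ?thesis by simp
      qed
    qed
    moreover have "cmod (cesaro_like \<mu> (g n) 0) \<le> m * \<delta>"
      unfolding cesaro_like_0[OF hol] norm_mult using N[OF n, of 0] R R' m
      by (intro mult_mono) (auto simp: moment_def)
    moreover have "m * \<delta> \<le> \<epsilon> / 4 * 1"
    proof -
      have "(R' - R) * (1 - R') \<le> 1 * 1" using R R' by (intro mult_mono) auto
      then have "\<epsilon> / 4 * ((R' - R) * (1 - R')) \<le> \<epsilon> / 4 * 1" using \<epsilon> by (intro mult_left_mono) auto
      then show ?thesis using m by (simp add: \<delta>_def)
    qed
    moreover have "0 \<le> bloch_norm \<beta> (cesaro_like \<mu> (g n))"
      using norm_0_le_bloch_norm[OF cesaro_like_maps_bloch[OF \<beta> lim g(1)]] norm_ge_zero order_trans by blast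
    ultimately show ?thesis using \<epsilon> by simp
  qed
  then show "\<exists>N. \<forall>n\<ge>N. norm (bloch_norm \<beta> (cesaro_like \<mu> (g n)) - 0) < \<epsilon>" by blast
qed

text \<open>The norm sees only the value at 0 and the derivative in the disc, and both depend
  linearly on the function.\<close>

lemma bloch_norm_cesaro_like_diff:
  assumes f: "f holomorphic_on unit_disc" and g: "g holomorphic_on unit_disc"
  shows "bloch_norm \<beta> (\<lambda>z. cesaro_like \<mu> f z - cesaro_like \<mu> g z) =
    bloch_norm \<beta> (cesaro_like \<mu> (\<lambda>z. f z - g z))"
proof -
  have hol: "cesaro_like \<mu> f holomorphic_on unit_disc" "cesaro_like \<mu> g holomorphic_on unit_disc"
    using cesaro_like_analytic[OF f] cesaro_like_analytic[OF g] by (auto simp: analytic_disc_def)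
  have "cesaro_like \<mu> f 0 - cesaro_like \<mu> g 0 = cesaro_like \<mu> (\<lambda>z. f z - g z) 0"
    unfolding cesaro_like_0[OF f] cesaro_like_0[OF g] cesaro_like_0[OF holomorphic_on_diff[OF f g]]
    by (simp add: right_diff_distrib)
  then show ?thesis
    unfolding bloch_norm_def
    using deriv_diff_disc[OF hol] deriv_cesaro_like_diff[OF f g] by simp
qed

text \<open>For a sequence of images, a subsequence of the preimages converges locally uniformly to
  some \<open>g\<close> in the Bloch space. The differences \<open>h n\<close> are bounded in norm
  and tend to 0 locally uniformly, so their images tend to 0 in norm.\<close>

lemma compact_operator_of_tail_limit:
  assumes \<beta>: "0 < \<beta>" and lim: "(log_tail \<beta> \<longlongrightarrow> 0) (at_left 1)"
  shows "compact_operator (bloch 1) (bloch_dist 1) (bloch \<beta>) (bloch_dist \<beta>) (cesaro_like \<mu>)"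
  unfolding compact_operator_def
proof (intro conjI allI impI)
  interpret B1: Metric_space "bloch 1" "bloch_dist 1" by (rule Metric_space_bloch)
  interpret B: Metric_space "bloch \<beta>" "bloch_dist \<beta>" by (rule Metric_space_bloch)
  note maps = cesaro_like_maps_bloch[OF \<beta> lim]
  show "cesaro_like \<mu> \<in> bloch 1 \<rightarrow> bloch \<beta>" using maps by blast
  fix S assume "B1.mbounded S"
  then obtain M where S: "S \<subseteq> bloch 1" and M: "\<And>f. f \<in> S \<Longrightarrow> bloch_norm 1 f \<le> M"
    unfolding mbounded_bloch_iff by blast
  have TS: "cesaro_like \<mu> ` S \<subseteq> bloch \<beta>" using maps S by blast
  show "compactin B.mtopology (B.mtopology closure_of (cesaro_like \<mu> ` S))"
    unfolding B.compact_closure_iff_sequential[OF TS]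
  proof (intro allI impI)
    fix \<sigma> :: "nat \<Rightarrow> complex \<Rightarrow> complex" assume "range \<sigma> \<subseteq> cesaro_like \<mu> ` S"
    then have "\<forall>n. \<exists>f. f \<in> S \<and> \<sigma> n = cesaro_like \<mu> f" by blast
    from choice[OF this] obtain f where fS: "\<And>n. f n \<in> S" and \<sigma>: "\<And>n. \<sigma> n = cesaro_like \<mu> (f n)"
      by blast
    have f: "\<And>n. f n \<in> bloch 1" "\<And>n. bloch_norm 1 (f n) \<le> M" using fS S M by auto
    obtain g and r :: "nat \<Rightarrow> nat" where g: "g \<in> bloch 1" and r: "strict_mono r"
      and unif: "\<And>R. R < 1 \<Longrightarrow> uniform_limit (cball 0 R) (\<lambda>n. f (r n)) g sequentially"
      by (rule Montel_bloch[OF f], rule that)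
    define h where "h n z = f (r n) z - g z" for n z
    have h: "h n \<in> bloch 1" for n
      unfolding h_def[abs_def] using f(1) g by (rule bloch_diff)
    have "bloch_norm 1 (h n) \<le> M + bloch_norm 1 g" for n
    proof -
      have "bloch_norm 1 (h n) = bloch_dist 1 (f (r n)) g"
        using f(1) g by (simp add: bloch_dist_def h_def[abs_def])
      also have "\<dots> \<le> bloch_dist 1 (f (r n)) (\<lambda>_. 0) + bloch_dist 1 g (\<lambda>_. 0)"
        using B1.triangle[OF f(1) zero_in_bloch g, of "r n"] B1.commute[of "\<lambda>_. 0" g] by simp
      finally show ?thesis using f g by (simp add: bloch_dist_0) (meson add_right_mono order_trans)
    qed
    moreover have "uniform_limit (cball 0 R) h (\<lambda>_. 0) sequentially" if "R < 1" for R
    proof -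
      have "uniform_limit (cball 0 R) (\<lambda>n z. f (r n) z - g z) (\<lambda>z. g z - g z) sequentially"
        by (intro uniform_limit_minus unif that uniform_limit_const)
      then show ?thesis by (simp add: h_def[abs_def])
    qed
    ultimately have to0: "(\<lambda>n. bloch_norm \<beta> (cesaro_like \<mu> (h n))) \<longlonglongrightarrow> 0"
      by (intro cesaro_like_null_sequence[OF \<beta> lim h])
    have dist_eq: "bloch_dist \<beta> (\<sigma> (r n)) (cesaro_like \<mu> g) = bloch_norm \<beta> (cesaro_like \<mu> (h n))" for n
      using bloch_norm_cesaro_like_diff[OF bloch_holomorphic[OF f(1)] bloch_holomorphic[OF g]]
        maps[OF f(1)] maps[OF g]
      by (simp add: bloch_dist_def \<sigma> h_def[abs_def])
    have "limitin B.mtopology (\<sigma> \<circ> r) (cesaro_like \<mu> g) sequentially"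
      unfolding B.limitin_metric
    proof (intro conjI allI impI)
      fix \<epsilon> :: real assume "0 < \<epsilon>"
      with to0 have "\<forall>\<^sub>F n in sequentially. bloch_norm \<beta> (cesaro_like \<mu> (h n)) < \<epsilon>"
        by (rule order_tendstoD)
      then show "\<forall>\<^sub>F n in sequentially. (\<sigma> \<circ> r) n \<in> bloch \<beta> \<and> bloch_dist \<beta> ((\<sigma> \<circ> r) n) (cesaro_like \<mu> g) < \<epsilon>"
        unfolding o_def dist_eq using maps[OF f(1)] by (simp add: \<sigma>)
    qed (rule maps[OF g])
    then show "\<exists>l r. l \<in> bloch \<beta> \<and> strict_mono r \<and> limitin B.mtopology (\<sigma> \<circ> r) l sequentially"
      using maps[OF g] r by blast
  qed
qed

end

section \<open>Test functions and necessity\<close>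

text \<open>The real part of the logarithm is \<open>ln (cmod (1 - w))\<close>, which lies between
  \<open>ln (1 - cmod w)\<close> and 1; the imaginary part is at most \<open>pi\<close>, hence at
  most 4. The constants add up to 6.\<close>

lemma norm_one_minus_Ln_le:
  assumes "cmod w < 1"
  shows "cmod (1 - Ln (1 - w)) \<le> 6 * (1 - ln (1 - cmod w))"
proof -
  have nz: "1 - w \<noteq> 0" using assms by auto
  have lower: "1 - cmod w \<le> cmod (1 - w)" using norm_triangle_ineq2[of 1 w] by simp
  have upper: "cmod (1 - w) \<le> 2" using norm_triangle_ineq4[of 1 w] assms by simp
  have "ln (1 - cmod w) \<le> ln (cmod (1 - w))" using lower assms nz by simp
  moreover have "ln (cmod (1 - w)) \<le> 1"
    using ln_le_minus_one[of "cmod (1 - w)"] upper nz by simp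
  moreover have "ln (1 - cmod w) \<le> 0" using assms by simp
  ultimately have "\<bar>Re (Ln (1 - w))\<bar> \<le> 1 - ln (1 - cmod w)"
    unfolding Re_Ln[OF nz] by (simp only: abs_le_iff) linarith
  moreover have "\<bar>Im (Ln (1 - w))\<bar> \<le> 4"
    using mpi_less_Im_Ln[OF nz] Im_Ln_le_pi[OF nz] pi_less_4 by linarith
  ultimately have "cmod (Ln (1 - w)) \<le> 5 - ln (1 - cmod w)"
    using cmod_le[of "Ln (1 - w)"] by linarith
  moreover have "6 - x \<le> 6 * (1 - x)" if "x \<le> 0" for x :: real
    using that by (simp add: algebra_simps)
  note this[OF \<open>ln (1 - cmod w) \<le> 0\<close>]
  ultimately show ?thesis
    using norm_triangle_ineq4[of 1 "Ln (1 - w)"] unfolding norm_one by linarith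
qed

text \<open>The factor \<open>ln (exp 1 / (1 - a))\<close> of the tail condition.\<close>

definition log_scale :: "real \<Rightarrow> real" where
  "log_scale a = 1 - ln (1 - a)"

text \<open>The square reconciles two demands: after division by \<open>log_scale a\<close> the
  function is still of size \<open>log_scale a\<close> near \<open>z = a\<close>, while on each
  smaller disc it tends to 0 as \<open>a\<close> tends to 1.\<close>

definition log_test :: "real \<Rightarrow> complex \<Rightarrow> complex" where
  "log_test a z = (if z \<in> unit_disc then (1 - Ln (1 - of_real a * z))\<^sup>2 / of_real (log_scale a) else 0)"

lemma log_scale_ge_1: "0 \<le> a \<Longrightarrow> a < 1 \<Longrightarrow> 1 \<le> log_scale a"
  by (simp add: log_scale_def)

lemma log_scale_mono: "0 \<le> a \<Longrightarrow> a \<le> b \<Longrightarrow> b < 1 \<Longrightarrow> log_scale a \<le> log_scale b"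
  by (simp add: log_scale_def)

lemma norm_one_minus_Ln_le_log_scale:
  assumes "cmod w \<le> r" "r < 1"
  shows "cmod (1 - Ln (1 - w)) \<le> 6 * log_scale r"
proof -
  have "cmod (1 - Ln (1 - w)) \<le> 6 * log_scale (cmod w)"
    unfolding log_scale_def using assms by (intro norm_one_minus_Ln_le) simp
  also have "\<dots> \<le> 6 * log_scale r"
    using log_scale_mono[of "cmod w" r] assms by simp
  finally show ?thesis .
qed

context
  fixes a :: real
  assumes a: "0 < a" "a < 1"
begin

lemma scaled_norm:
  assumes "cmod z < 1"
  shows "cmod (of_real a * z) \<le> a" "cmod (of_real a * z) \<le> cmod z" "cmod (of_real a * z) < 1"
  using assms a mult_left_le[of "cmod z" a] mult_left_le_one_le[of "cmod z" a] by (auto simp: norm_mult)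

lemma log_test_field_derivative:
  assumes z: "cmod z < 1"
  shows "(log_test a has_field_derivative
    2 * (1 - Ln (1 - of_real a * z)) * (of_real a / (1 - of_real a * z)) / of_real (log_scale a)) (at z)"
proof (rule has_field_derivative_transform_within_open[OF _ open_ball])
  \<comment> \<open>A positive real part keeps \<open>1 - a * z\<close> off the branch cut of
    \<open>Ln\<close>.\<close>
  have "Re (of_real a * z) < 1"
    using scaled_norm(3)[OF z] complex_Re_le_cmod[of "of_real a * z"] by linarith
  then have "0 < Re (1 - of_real a * z)" by simp
  then have "1 - of_real a * z \<notin> \<real>\<^sub>\<le>\<^sub>0"
    unfolding complex_nonpos_Reals_iff by linarith
  then show "((\<lambda>z. (1 - Ln (1 - of_real a * z))\<^sup>2 / of_real (log_scale a)) has_field_derivative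
    2 * (1 - Ln (1 - of_real a * z)) * (of_real a / (1 - of_real a * z)) / of_real (log_scale a)) (at z)"
    by (auto intro!: derivative_eq_intros simp: divide_inverse mult_ac)
  show "z \<in> unit_disc" using z by simp
qed (simp add: log_test_def)

lemma log_test_holomorphic: "log_test a holomorphic_on unit_disc"
  unfolding holomorphic_on_open[OF open_ball]
  by (intro ballI exI, rule log_test_field_derivative) simp

lemma deriv_log_test:
  assumes "cmod z < 1"
  shows "deriv (log_test a) z =
    2 * (1 - Ln (1 - of_real a * z)) * (of_real a / (1 - of_real a * z)) / of_real (log_scale a)"
  using log_test_field_derivative[OF assms] by (rule DERIV_imp_deriv)

text \<open>The radius \<open>r\<close> is left free for two uses: with \<open>r = a\<close> the
  logarithms cancel and give the Bloch bound, with \<open>r\<close> fixed the quotient tends to 0 as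
  \<open>a\<close> tends to 1.\<close>

lemma norm_deriv_log_test_le:
  assumes z: "cmod z < 1" and r: "cmod (of_real a * z) \<le> r" "r < 1"
  shows "cmod (deriv (log_test a) z) \<le> 12 * log_scale r / (1 - cmod z) / log_scale a"
proof -
  have "1 - cmod z \<le> cmod (1 - of_real a * z)"
    using norm_triangle_ineq2[of 1 "of_real a * z"] scaled_norm(2)[OF z] by simp
  then have "a / cmod (1 - of_real a * z) \<le> 1 / (1 - cmod z)"
    using a z by (intro frac_le) auto
  then have "cmod (1 - Ln (1 - of_real a * z)) * (a / cmod (1 - of_real a * z)) \<le>
      6 * log_scale r * (1 / (1 - cmod z))"
    using norm_one_minus_Ln_le_log_scale[OF r] a
      order_trans[OF norm_ge_zero norm_one_minus_Ln_le_log_scale[OF r]]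
    by (intro mult_mono) auto
  then have "2 * (cmod (1 - Ln (1 - of_real a * z)) * (a / cmod (1 - of_real a * z))) / log_scale a \<le>
      2 * (6 * log_scale r * (1 / (1 - cmod z))) / log_scale a"
    using log_scale_ge_1[of a] a by (intro divide_right_mono mult_left_mono) auto
  then show ?thesis
    using log_scale_ge_1[of a] a
    unfolding deriv_log_test[OF z] norm_mult norm_divide norm_of_real by (simp add: mult.assoc)
qed

text \<open>The weighted derivative is at most \<open>2 * 12\<close>, and the value at 0 is
  \<open>1 / log_scale a\<close>, at most 1.\<close>

lemma log_test_in_bloch: "log_test a \<in> bloch 1"
  and bloch_norm_log_test_le: "bloch_norm 1 (log_test a) \<le> 25"
proof -
  have an: "log_test a \<in> analytic_disc"
    using log_test_holomorphic by (auto simp: analytic_disc_def log_test_def)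
  have "(1 - (cmod z)\<^sup>2) powr 1 * cmod (deriv (log_test a) z) \<le> 24" if z: "cmod z < 1" for z
  proof -
    have "cmod (deriv (log_test a) z) \<le> 12 / (1 - cmod z)"
      using norm_deriv_log_test_le[OF z scaled_norm(1)[OF z] a(2)] log_scale_ge_1[of a] a by simp
    then have "(1 - (cmod z)\<^sup>2) * cmod (deriv (log_test a) z) \<le> (2 * (1 - cmod z)) * (12 / (1 - cmod z))"
      using one_minus_norm_le[OF z] z by (intro mult_mono) auto
    also have "\<dots> = 24"
    proof -
      have *: "2 * x * (12 / x) = 24" if "x \<noteq> 0" for x :: real using that by simp
      show ?thesis by (rule *) (use z in simp)
    qed
    finally show ?thesis using z one_minus_norm_le[OF z] by simp
  qed
  note * = blochI[OF an this] bloch_norm_le[OF an this]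
  show "log_test a \<in> bloch 1" using *(1) .
  have "cmod (log_test a 0) \<le> 1"
    using log_scale_ge_1[of a] a by (simp add: log_test_def norm_divide)
  with *(2) show "bloch_norm 1 (log_test a) \<le> 25" by simp
qed

text \<open>The numerator depends on \<open>r\<close> only, so the kernel tends to 0 uniformly on
  the disc of radius \<open>r\<close> as \<open>a\<close> tends to 1.\<close>

lemma cesaro_kernel_log_test_le:
  assumes w: "cmod w \<le> r" and r: "r < 1"
  shows "cmod (cesaro_kernel (log_test a) w) \<le>
    (12 * log_scale r / (1 - r) / (1 - r) + (6 * log_scale r)\<^sup>2 / (1 - r)\<^sup>2) / log_scale a"
proof -
  have w1: "cmod w < 1" using w r by simp
  have aw: "cmod (of_real a * w) \<le> r" using scaled_norm(2)[OF w1] w by simp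
  have L: "1 \<le> log_scale a" using log_scale_ge_1[of a] a by simp
  have Lr: "1 \<le> log_scale r" using log_scale_ge_1[of r] w r norm_ge_zero[of w] by linarith
  have den: "1 - r \<le> cmod (1 - w)" using norm_triangle_ineq2[of 1 w] w by simp
  have "cmod (deriv (log_test a) w) \<le> 12 * log_scale r / (1 - cmod w) / log_scale a"
    by (rule norm_deriv_log_test_le[OF w1 aw r])
  also have "\<dots> \<le> 12 * log_scale r / (1 - r) / log_scale a"
    using w r L Lr by (intro divide_right_mono divide_left_mono) auto
  finally have "cmod (deriv (log_test a) w) / cmod (1 - w) \<le>
      (12 * log_scale r / (1 - r) / log_scale a) / (1 - r)"
    using den r L Lr by (intro frac_le) auto
  moreover have "cmod (log_test a w) = (cmod (1 - Ln (1 - of_real a * w)))\<^sup>2 / log_scale a"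
    using w1 L by (simp add: log_test_def norm_divide norm_power)
  then have "cmod (log_test a w) \<le> (6 * log_scale r)\<^sup>2 / log_scale a"
    using power_mono[OF norm_one_minus_Ln_le_log_scale[OF aw r] norm_ge_zero] L
    by (metis divide_right_mono order_trans zero_le_one)
  then have "cmod (log_test a w) / (cmod (1 - w))\<^sup>2 \<le> (6 * log_scale r)\<^sup>2 / log_scale a / (1 - r)\<^sup>2"
    using den r L by (intro frac_le power_mono) auto
  moreover have "cmod (cesaro_kernel (log_test a) w) \<le>
      cmod (deriv (log_test a) w) / cmod (1 - w) + cmod (log_test a w) / (cmod (1 - w))\<^sup>2"
    unfolding cesaro_kernel_def norm_divide[symmetric] norm_power[symmetric] by (rule norm_triangle_ineq)
  ultimately show ?thesis
    by (simp add: add_divide_distrib mult.commute mult.left_commute)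
qed

text \<open>On the real radius both summands are nonnegative, so nothing cancels in the integral and
  either summand may be dropped from below.\<close>

lemma cesaro_kernel_log_test_real:
  assumes s: "0 \<le> s" "s < 1"
  shows "cesaro_kernel (log_test a) (of_real s) = of_real
    (2 * log_scale (a * s) * (a / (1 - a * s)) / log_scale a / (1 - s) +
      (log_scale (a * s))\<^sup>2 / log_scale a / (1 - s)\<^sup>2)"
proof -
  have "a * s < 1" using a s mult_strict_mono'[of a 1 s 1] by simp
  then have "Ln (1 - of_real a * of_real s) = of_real (ln (1 - a * s))"
    using Ln_of_real[of "1 - a * s"] by simp
  then show ?thesis
    using s by (simp add: cesaro_kernel_def deriv_log_test log_test_def log_scale_def)
qed

text \<open>With \<open>x = 1 - a\<close>, the quantity \<open>1 - a ^ 3\<close> is at most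
  \<open>3 * x\<close>, and this is at most \<open>sqrt x\<close> exactly when
  \<open>x \<le> 1 / 9\<close>; hence the bound \<open>8 / 9\<close>. The square root halves the
  logarithm. The cube arises because \<open>a * (t * a)\<close> is at least \<open>a ^ 3\<close> for
  \<open>t \<ge> a\<close>.\<close>

lemma log_scale_cube_ge:
  assumes "8 / 9 \<le> a"
  shows "log_scale a / 2 \<le> log_scale (a ^ 3)"
proof -
  define x where "x = 1 - a"
  have x: "0 < x" "x \<le> 1 / 9" using a assms by (auto simp: x_def)
  have "a ^ 3 = 1 - 3 * x + 3 * x\<^sup>2 - x ^ 3"
    by (simp add: x_def power2_eq_square power3_eq_cube algebra_simps)
  moreover have "x ^ 3 \<le> 3 * x\<^sup>2" using x by (simp add: power2_eq_square power3_eq_cube)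
  ultimately have "1 - a ^ 3 \<le> 3 * x" by simp
  moreover have "a ^ 3 < 1" using a by (simp add: power_less_one_iff)
  moreover have "3 * x \<le> sqrt x"
    using x by (intro real_le_rsqrt) (simp add: power2_eq_square)
  ultimately have "ln (1 - a ^ 3) \<le> ln (sqrt x)" using x by simp
  also have "\<dots> = ln x / 2" using x by (simp add: ln_sqrt)
  finally show ?thesis by (simp add: log_scale_def x_def)
qed

end

section \<open>Recovering the tail from the test functions\<close>

context unit_interval_measure
begin

text \<open>At \<open>z = a\<close> the integrand is real and nonnegative, so restricting it to
  \<open>t \<ge> a\<close> and keeping the second summand of the kernel gives a lower bound. There
  the logarithm is at least \<open>log_scale a / 2\<close>, whose square produces the 4, and
  \<open>1 - t * a\<close> is at most \<open>1 - a\<^sup>2\<close>.\<close>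

lemma deriv_cesaro_like_log_test_lower:
  assumes a: "8 / 9 \<le> a" "a < 1"
  shows "measure \<mu> {a..<1} * (a * log_scale a / 4 / (1 - a\<^sup>2)\<^sup>2) \<le>
    cmod (deriv (cesaro_like \<mu> (log_test a)) (of_real a))"
proof -
  have a0: "0 < a" using a by simp
  note hol = log_test_holomorphic[OF a0 a(2)]
  have z: "cmod (of_real a) < 1" using a a0 by simp
  define k where "k s = 2 * log_scale (a * s) * (a / (1 - a * s)) / log_scale a / (1 - s)
    + (log_scale (a * s))\<^sup>2 / log_scale a / (1 - s)\<^sup>2" for s
  let ?c = "a * log_scale a / 4 / (1 - a\<^sup>2)\<^sup>2"
  have L: "1 \<le> log_scale a" using log_scale_ge_1[of a] a by simp
  let ?F = "\<lambda>t. complex_of_real t * cesaro_kernel (log_test a) (of_real t * of_real a)"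
  have F: "?F t = of_real (t * k (t * a))" if "0 \<le> t" "t < 1" for t
  proof -
    have "0 \<le> t * a" "t * a < 1" using that a a0 mult_strict_mono'[of t 1 a 1] by auto
    from cesaro_kernel_log_test_real[OF a0 a(2) this] show ?thesis by (simp add: k_def)
  qed
  have nonneg: "0 \<le> t * k (t * a)" "t \<ge> a \<Longrightarrow> ?c \<le> t * k (t * a)" if t: "0 \<le> t" "t < 1" for t
  proof -
    have ta: "0 \<le> t * a" "t * a < 1" "a * (t * a) < 1"
      using t a a0 mult_strict_mono'[of t 1 a 1] mult_strict_mono'[of a 1 "t * a" 1] by auto
    have L1: "1 \<le> log_scale (a * (t * a))" using ta a0 by (intro log_scale_ge_1) auto
    have first: "0 \<le> 2 * log_scale (a * (t * a)) * (a / (1 - a * (t * a))) / log_scale a / (1 - t * a)"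
      using L1 L ta a0 by simp
    then show "0 \<le> t * k (t * a)" using t L unfolding k_def by simp
    assume "a \<le> t"
    then have "a * a \<le> t * a" using a0 by simp
    then have "a ^ 3 \<le> a * (t * a)" using a0 by (simp add: power3_eq_cube mult.assoc)
    then have "log_scale a / 2 \<le> log_scale (a * (t * a))"
      using log_scale_cube_ge[OF a0 a(2,1)] log_scale_mono[of "a ^ 3" "a * (t * a)"] ta a0 by simp
    then have "(log_scale a / 2)\<^sup>2 \<le> (log_scale (a * (t * a)))\<^sup>2"
      using L by (intro power_mono) auto
    moreover have "(1 - t * a)\<^sup>2 \<le> (1 - a\<^sup>2)\<^sup>2"
      using \<open>a * a \<le> t * a\<close> ta by (intro power_mono) (auto simp: power2_eq_square)
    ultimately have "(log_scale a / 2)\<^sup>2 / log_scale a / (1 - a\<^sup>2)\<^sup>2 \<le>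
        (log_scale (a * (t * a)))\<^sup>2 / log_scale a / (1 - t * a)\<^sup>2"
      using L ta by (intro frac_le divide_right_mono) auto
    also have "\<dots> \<le> k (t * a)" using first unfolding k_def by simp
    finally have "log_scale a / 4 / (1 - a\<^sup>2)\<^sup>2 \<le> k (t * a)"
      using L by (simp add: power2_eq_square)
    then have "a * (log_scale a / 4 / (1 - a\<^sup>2)\<^sup>2) \<le> t * k (t * a)"
      using \<open>a \<le> t\<close> a0 t L by (intro mult_mono) auto
    then show "?c \<le> t * k (t * a)" by simp
  qed
  have meas: "{a..<1} \<in> sets \<mu>" using a0 by (intro tail_measurable) simp
  have int: "integrable \<mu> ?F"
    by (intro integrable_dilation cesaro_kernel_holomorphic hol z)
  have "measure \<mu> {a..<1} * ?c = (\<integral>t. indicator {a..<1} t * ?c \<partial>\<mu>)"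
    using sets.sets_into_space[OF meas] by (simp add: Int_absorb2)
  also have "\<dots> \<le> (\<integral>t. Re (?F t) \<partial>\<mu>)"
  proof (rule integral_mono)
    show "integrable \<mu> (\<lambda>t. indicator {a..<1} t * ?c)"
      using meas by (intro integrable_mult_left integrable_real_indicator) (auto simp: emeasure_eq_measure)
    show "integrable \<mu> (\<lambda>t. Re (?F t))" using int by (rule integrable_Re)
    fix t assume "t \<in> space \<mu>"
    then have t: "0 \<le> t" "t < 1" by (auto simp: space_eq)
    show "indicator {a..<1} t * ?c \<le> Re (?F t)"
      unfolding F[OF t] Re_complex_of_real using nonneg[OF t] t by (auto simp: indicator_def)
  qed
  also have "\<dots> = Re (\<integral>t. ?F t \<partial>\<mu>)" using int by (rule integral_Re)
  also have "\<dots> \<le> cmod (deriv (cesaro_like \<mu> (log_test a)) (of_real a))"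
    unfolding deriv_cesaro_like[OF hol z] by (rule complex_Re_le_cmod)
  finally show ?thesis .
qed

lemma log_tail_eq:
  assumes "a < 1"
  shows "log_tail \<beta> a = measure \<mu> {a..<1} * log_scale a / (1 - a) powr (2 - \<beta>)"
  using assms by (simp add: log_tail_def log_scale_def ln_div)

text \<open>The constant 32 collects 4 from replacing \<open>1 - a\<close> by
  \<open>1 - a\<^sup>2\<close> under the exponent \<open>2 - \<beta>\<close>, which lies in
  \<open>[0, 2)\<close>, another 4 from the lower bound, and 2 from
  \<open>1 \<le> 2 * a\<close>.\<close>

lemma log_tail_le:
  assumes a: "8 / 9 \<le> a" "a < 1" and \<beta>: "\<beta> \<le> 2" "0 < \<beta>"
  shows "log_tail \<beta> a \<le> 32 *
    ((1 - (cmod (of_real a))\<^sup>2) powr \<beta> * cmod (deriv (cesaro_like \<mu> (log_test a)) (of_real a)))"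
proof -
  define p where "p = 1 - a\<^sup>2"
  have p: "0 < p" "p \<le> 2 * (1 - a)"
    using one_minus_norm_le[of "of_real a"] a by (auto simp: p_def)
  have L: "1 \<le> log_scale a" using log_scale_ge_1[of a] a by simp
  have "p powr (2 - \<beta>) \<le> (2 * (1 - a)) powr (2 - \<beta>)"
    using p \<beta> by (intro powr_mono2) auto
  also have "\<dots> = 2 powr (2 - \<beta>) * (1 - a) powr (2 - \<beta>)" by (rule powr_mult)
  also have "\<dots> \<le> 4 * (1 - a) powr (2 - \<beta>)"
    using powr_mono[of "2 - \<beta>" 2 2] \<beta> by (intro mult_right_mono) auto
  finally have "1 / (1 - a) powr (2 - \<beta>) \<le> 4 / p powr (2 - \<beta>)"
    using p a by (simp add: field_simps)
  then have "measure \<mu> {a..<1} * log_scale a * (1 / (1 - a) powr (2 - \<beta>)) \<le>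
      measure \<mu> {a..<1} * log_scale a * (4 / p powr (2 - \<beta>))"
    using L by (intro mult_left_mono) auto
  then have "log_tail \<beta> a \<le> measure \<mu> {a..<1} * log_scale a * (4 / p powr (2 - \<beta>))"
    using a by (simp add: log_tail_eq)
  also have "\<dots> = measure \<mu> {a..<1} * log_scale a * (4 / p powr (2 - \<beta>)) * 1"
    by simp
  also have "4 / p powr (2 - \<beta>) = 4 * (p powr \<beta> / p\<^sup>2)"
    using p by (simp add: powr_diff)
  also have "measure \<mu> {a..<1} * log_scale a * (4 * (p powr \<beta> / p\<^sup>2)) * 1 \<le>
      measure \<mu> {a..<1} * log_scale a * (4 * (p powr \<beta> / p\<^sup>2)) * (2 * a)"
    using a L p by (intro mult_left_mono) auto
  also have "\<dots> = 32 * (p powr \<beta> * (measure \<mu> {a..<1} * (a * log_scale a / 4 / p\<^sup>2)))"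
    by simp
  also have "\<dots> \<le> 32 * (p powr \<beta> * cmod (deriv (cesaro_like \<mu> (log_test a)) (of_real a)))"
    using deriv_cesaro_like_log_test_lower[OF a] by (intro mult_left_mono) (auto simp: p_def)
  finally show ?thesis by (simp add: p_def)
qed

lemma deriv_cesaro_like_log_test_tendsto:
  assumes a: "\<And>n. 0 < a n" "\<And>n. a n < 1" "a \<longlonglongrightarrow> 1" and z: "cmod z < 1"
  shows "(\<lambda>n. deriv (cesaro_like \<mu> (log_test (a n))) z) \<longlonglongrightarrow> 0"
proof -
  define C where "C = 12 * log_scale (cmod z) / (1 - cmod z) / (1 - cmod z) +
    (6 * log_scale (cmod z))\<^sup>2 / (1 - cmod z)\<^sup>2"
  have bound: "cmod (deriv (cesaro_like \<mu> (log_test (a n))) z) \<le>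
      C / log_scale (a n) * measure \<mu> (space \<mu>)" for n
    using cesaro_kernel_log_test_le[OF a(1,2) _ z]
    by (intro norm_deriv_cesaro_like_le[OF log_test_holomorphic[OF a(1,2)] z]) (simp add: C_def)
  have "filterlim (\<lambda>n. 1 - a n) (at_right 0) sequentially"
  proof (rule tendsto_imp_filterlim_at_right)
    show "(\<lambda>n. 1 - a n) \<longlonglongrightarrow> 0" using tendsto_diff[OF tendsto_const a(3), of 1] by simp
  qed (use a in auto)
  then have "filterlim (\<lambda>n. ln (1 - a n)) at_bot sequentially"
    by (rule filterlim_compose[OF ln_at_0])
  then have "filterlim (\<lambda>n. 1 + - ln (1 - a n)) at_top sequentially"
    by (intro filterlim_tendsto_add_at_top[OF tendsto_const])
      (simp add: filterlim_uminus_at_top[symmetric] filterlim_uminus_at_bot)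
  then have "filterlim (\<lambda>n. log_scale (a n)) at_top sequentially"
    by (simp add: log_scale_def)
  then have "(\<lambda>n. C / log_scale (a n)) \<longlonglongrightarrow> 0"
    by (intro tendsto_divide_0[OF tendsto_const] filterlim_at_top_imp_at_infinity)
  then have "(\<lambda>n. C / log_scale (a n) * measure \<mu> (space \<mu>)) \<longlonglongrightarrow> 0"
    by (rule tendsto_mult_left_zero)
  then show ?thesis
    by (rule Lim_null_comparison[OF always_eventually, rotated]) (use bound in blast)
qed

text \<open>If the limit fails, tails of size at least \<open>\<epsilon>\<close> occur along a
  sequence tending to 1. Compactness provides a norm limit \<open>g\<close> of images of the
  corresponding test functions; pointwise limits of derivatives force \<open>g\<close> to have zero
  derivative, while the derivatives at the points \<open>b n\<close> keep the distance to
  \<open>g\<close> away from 0.\<close>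

lemma tail_limit_of_compact_operator:
  assumes \<beta>: "0 < \<beta>" "\<beta> \<le> 2"
    and compact: "compact_operator (bloch 1) (bloch_dist 1) (bloch \<beta>) (bloch_dist \<beta>) (cesaro_like \<mu>)"
  shows "(log_tail \<beta> \<longlongrightarrow> 0) (at_left 1)"
proof (rule ccontr)
  assume "\<not> ?thesis"
  then obtain \<epsilon> where \<epsilon>: "0 < \<epsilon>" and not_ev: "\<not> (\<forall>\<^sub>F t in at_left 1. dist (log_tail \<beta> t) 0 < \<epsilon>)"
    by (auto simp: tendsto_iff)
  \<comment> \<open>The summand 9 places every term, including the one for \<open>n = 0\<close>,
    above \<open>8 / 9\<close>, where the lower bound is valid.\<close>
  have "\<exists>t. 1 - 1 / (real n + 9) < t \<and> t < 1 \<and> \<epsilon> \<le> \<bar>log_tail \<beta> t\<bar>" for n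
  proof (rule ccontr)
    assume "\<not> ?thesis"
    then have "\<And>t. 1 - 1 / (real n + 9) < t \<Longrightarrow> t < 1 \<Longrightarrow> dist (log_tail \<beta> t) 0 < \<epsilon>"
      by (auto simp: not_le)
    then have "\<forall>\<^sub>F t in at_left 1. dist (log_tail \<beta> t) 0 < \<epsilon>"
      by (intro eventually_at_leftI[of "1 - 1 / (real n + 9)"]) auto
    with not_ev show False by contradiction
  qed
  then obtain a where a: "\<And>n. 1 - 1 / (real n + 9) < a n" "\<And>n. a n < 1"
    and large: "\<And>n. \<epsilon> \<le> \<bar>log_tail \<beta> (a n)\<bar>" by metis
  have a89: "8 / 9 \<le> a n" for n
  proof -
    have "1 / (real n + 9) \<le> 1 / 9" by (intro divide_left_mono) auto
    then show ?thesis using a(1)[of n] by linarith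
  qed
  have a0: "0 < a n" for n using a89[of n] by simp
  have a_lim: "a \<longlonglongrightarrow> 1"
  proof (rule tendsto_sandwich[OF _ _ _ tendsto_const])
    have "filterlim (\<lambda>n. 9 + real n) at_top sequentially"
      by (intro filterlim_tendsto_add_at_top[OF tendsto_const] filterlim_real_sequentially)
    then have "(\<lambda>n. 1 / (9 + real n)) \<longlonglongrightarrow> 0"
      by (intro tendsto_divide_0[OF tendsto_const] filterlim_at_top_imp_at_infinity)
    from tendsto_diff[OF tendsto_const this, of 1]
    show "(\<lambda>n. 1 - 1 / (real n + 9)) \<longlonglongrightarrow> 1" by (simp add: add.commute)
  qed (use a in \<open>auto intro!: always_eventually less_imp_le\<close>)
  interpret B: Metric_space "bloch \<beta>" "bloch_dist \<beta>" by (rule Metric_space_bloch)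
  define S where "S = range (\<lambda>n. log_test (a n))"
  have S: "S \<subseteq> bloch 1" using log_test_in_bloch[OF a0 a(2)] by (auto simp: S_def)
  have maps: "cesaro_like \<mu> f \<in> bloch \<beta>" if "f \<in> bloch 1" for f
    using compact that by (auto simp: compact_operator_def)
  have "Metric_space.mbounded (bloch 1) (bloch_dist 1) S"
    unfolding mbounded_bloch_iff using S bloch_norm_log_test_le[OF a0 a(2)] by (auto simp: S_def)
  then have "compactin B.mtopology (B.mtopology closure_of (cesaro_like \<mu> ` S))"
    using compact by (simp add: compact_operator_def)
  moreover have "cesaro_like \<mu> ` S \<subseteq> bloch \<beta>" using maps S by blast
  moreover have "range (\<lambda>n. cesaro_like \<mu> (log_test (a n))) \<subseteq> cesaro_like \<mu> ` S" by (auto simp: S_def)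
  ultimately obtain g and r :: "nat \<Rightarrow> nat" where g: "g \<in> bloch \<beta>" and r: "strict_mono r"
    and lim: "limitin B.mtopology ((\<lambda>n. cesaro_like \<mu> (log_test (a n))) \<circ> r) g sequentially"
    by (metis B.compact_closure_iff_sequential)
  define b where "b n = a (r n)" for n
  have b: "0 < b n" "b n < 1" "8 / 9 \<le> b n" for n using a0 a(2) a89 by (auto simp: b_def)
  have b_lim: "b \<longlonglongrightarrow> 1"
    using LIMSEQ_subseq_LIMSEQ[OF a_lim r] by (simp add: b_def[abs_def] o_def)
  let ?T = "\<lambda>n. cesaro_like \<mu> (log_test (b n))"
  have T: "?T n \<in> bloch \<beta>" for n
    using log_test_in_bloch[OF b(1,2)] by (rule maps)
  have dist_lim: "(\<lambda>n. bloch_dist \<beta> (?T n) g) \<longlonglongrightarrow> 0"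
    using lim by (simp add: B.limitin_metric_dist_null b_def o_def)
  have deriv_le: "(1 - (cmod z)\<^sup>2) powr \<beta> * cmod (deriv (?T n) z - deriv g z) \<le> bloch_dist \<beta> (?T n) g"
    if z: "cmod z < 1" for z n
  proof -
    have "bloch_dist \<beta> (?T n) g = bloch_norm \<beta> (\<lambda>z. ?T n z - g z)"
      using T g by (simp add: bloch_dist_def)
    then show ?thesis
      using bloch_deriv_le[OF bloch_diff[OF T g] z, of n] norm_ge_zero[of "?T n 0 - g 0"]
      unfolding deriv_diff_disc[OF bloch_holomorphic[OF T] bloch_holomorphic[OF g] z]
      by linarith
  qed
  have deriv_g: "deriv g z = 0" if z: "cmod z < 1" for z
  proof -
    have "(\<lambda>n. (1 - (cmod z)\<^sup>2) powr \<beta> * cmod (deriv (?T n) z - deriv g z)) \<longlonglongrightarrow>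
        (1 - (cmod z)\<^sup>2) powr \<beta> * cmod (0 - deriv g z)"
      by (intro tendsto_intros deriv_cesaro_like_log_test_tendsto b b_lim z)
    then have "(1 - (cmod z)\<^sup>2) powr \<beta> * cmod (0 - deriv g z) \<le> 0"
      using LIMSEQ_le[OF _ dist_lim] deriv_le[OF z] by blast
    moreover have "(cmod z)\<^sup>2 < 1" using z by (simp add: abs_square_less_1)
    then have "0 < (1 - (cmod z)\<^sup>2) powr \<beta>" by simp
    ultimately show ?thesis by (simp add: mult_le_0_iff)
  qed
  \<comment> \<open>The evaluation point \<open>b n\<close> moves with \<open>n\<close>; the norm
    controls the weighted derivative there too, uniformly up to the boundary.\<close>
  have ge: "\<epsilon> \<le> 32 * bloch_dist \<beta> (?T n) g" for n
  proof -
    have z: "cmod (of_real (b n)) < 1" using b[of n] by simp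
    have "0 \<le> log_tail \<beta> (b n)"
      using b[of n] log_scale_ge_1[of "b n"] by (simp add: log_tail_eq)
    then have "\<epsilon> \<le> log_tail \<beta> (b n)" using large[of "r n"] by (simp add: b_def)
    also have "\<dots> \<le> 32 * bloch_dist \<beta> (?T n) g"
      using log_tail_le[OF b(3,2) \<beta>(2,1), of n] deriv_le[OF z, of n] deriv_g[OF z] by simp
    finally show ?thesis .
  qed
  have "(\<lambda>n. 32 * bloch_dist \<beta> (?T n) g) \<longlonglongrightarrow> 0"
    using dist_lim by (rule tendsto_mult_right_zero)
  then have "\<epsilon> \<le> 0" by (rule LIMSEQ_le_const) (use ge in blast)
  with \<epsilon> show False by simp
qed

end

theorem theorem4p2:
  fixes \<mu> :: "real measure" and \<beta> :: real
  assumes "finite_measure \<mu>"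
    and "sets \<mu> = sets (restrict_space borel {0..<1})"
    and "0 < \<beta>" and "\<beta> \<le> 2"
  shows "compact_operator (bloch 1) (bloch_dist 1) (bloch \<beta>) (bloch_dist \<beta>) (cesaro_like \<mu>) \<longleftrightarrow>
    ((\<lambda>t. measure \<mu> {t..<1} * ln (exp 1 / (1 - t)) / (1 - t) powr (2 - \<beta>)) \<longlongrightarrow> 0) (at_left 1)"
proof -
  interpret unit_interval_measure \<mu>
    using assms(1,2) by (simp add: unit_interval_measure_def unit_interval_measure_axioms_def)
  show ?thesis
    using compact_operator_of_tail_limit tail_limit_of_compact_operator assms(3,4)
    unfolding log_tail_def[abs_def] by blast
qed

end
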